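(* Let $\epsilon\in\{-1,1\}$ be fixed. The equivalence groupoid $\mathcal G^\sim_{\mathcal F^\epsilon}$ of the class $\mathcal F^\epsilon$ is constituted by the triples of the form $(B,\Phi,\tilde B)$, where $B$ and $\tilde B$ are the drifts of the source and the target Fokker--Planck equations, respectively, and $\Phi$ is a point transformation with the components \[ \tilde t=T(t),\quad\tilde x=X^1(t)x+X^0(t),\quad\tilde u=U^1(t,x)u+U^0(t,x), \] where $T$, $X^0$ and $X^1$ are arbitrary smooth functions of $t$ with $X^1\neq0$ and $T_t=(X^1)^2$, $X^1U^1$ is an arbitrary nonzero solution of the adjoint equation to $\mathcal F^\epsilon_B$, \[ (X^1U^1)_t=-\epsilon X^1U^1_{xx}+BX^1U^1_x, \] and $U^0$ is an arbitrary solution of the source equation $\mathcal F^\epsilon_B$. The relation between the source and the target drifts is given by \[ \Phi^*\tilde B=\frac1{X^1}\left(B-2\epsilon\frac{U^1_x}{U^1}\right)-\frac{X^1_tx+X^0_t}{(X^1)^2}. \]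
   Context: Everything is real, smooth and local; "nonzero" and $f\neq0$ for a function mean that it vanishes nowhere on its domain. The class $\mathcal F^\epsilon$ consists of the reduced Fokker--Planck equations $\mathcal F^\epsilon_B$: $u_t=\epsilon u_{xx}+(B(t,x)u)_x$, where the drift $B$ is an arbitrary smooth function of $(t,x)$. The equivalence groupoid of the class is the set of its admissible transformations, i.e. of the triples $(B,\Phi,\tilde B)$ in which $\Phi$ is a point transformation (a local diffeomorphism of the space of $(t,x,u)$) mapping $\mathcal F^\epsilon_B$ to $\mathcal F^\epsilon_{\tilde B}$. $\Phi^*\tilde B$ denotes $\tilde B(T(t),X^1(t)x+X^0(t))$.
   Formalization: The condition that U^0 solves the source equation is false as written and is corrected to U^0/U^1 solving it; the domain of Φ is assumed to have connected t-slices and connected (t,x)-fibres, so that T, X^0, X^1, U^1, U^0 are single-valued (always true locally). *)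

theory Defs
  imports "HOL-Analysis.Analysis"
begin

text \<open>
  Points of the base are pairs \<open>(t, x)\<close>, points of the space of independent and dependent
  variables are triples \<open>(t, x, u)\<close>. All objects are local: a function comes with an open domain,
  and its values outside that domain never matter.
\<close>

text \<open>
  \<open>Ck_on S f k\<close> is meant for open \<open>S\<close>; the derivatives are two-sided Frechet derivatives, taken in
  every fixed direction \<open>v\<close>.
\<close>

primrec Ck_on :: "'a::real_normed_vector set \<Rightarrow> ('a \<Rightarrow> 'b::real_normed_vector) \<Rightarrow> nat \<Rightarrow> bool" where
  "Ck_on S f 0 \<longleftrightarrow> continuous_on S f"
| "Ck_on S f (Suc k) \<longleftrightarrow>
     (\<forall>p\<in>S. f differentiable (at p)) \<and>
     (\<forall>v. Ck_on S (\<lambda>p. frechet_derivative f (at p) v) k)"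

definition smooth_on :: "'a::real_normed_vector set \<Rightarrow> ('a \<Rightarrow> 'b::real_normed_vector) \<Rightarrow> bool" where
  "smooth_on S f \<longleftrightarrow> (\<forall>k. Ck_on S f k)"

definition Dt :: "(real \<times> real \<Rightarrow> real) \<Rightarrow> real \<times> real \<Rightarrow> real" where
  "Dt f = (\<lambda>(t, x). deriv (\<lambda>s. f (s, x)) t)"

definition Dx :: "(real \<times> real \<Rightarrow> real) \<Rightarrow> real \<times> real \<Rightarrow> real" where
  "Dx f = (\<lambda>(t, x). deriv (\<lambda>y. f (t, y)) x)"

definition FP_solution ::
  "real \<Rightarrow> (real \<times> real \<Rightarrow> real) \<Rightarrow> (real \<times> real) set \<Rightarrow> (real \<times> real \<Rightarrow> real) \<Rightarrow> bool" where
  "FP_solution \<epsilon> B W f \<longleftrightarrow> smooth_on W f \<and>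
     (\<forall>p\<in>W. Dt f p = \<epsilon> * Dx (Dx f) p + Dx (\<lambda>q. B q * f q) p)"

definition adjoint_solution ::
  "real \<Rightarrow> (real \<times> real \<Rightarrow> real) \<Rightarrow> (real \<times> real) set \<Rightarrow> (real \<times> real \<Rightarrow> real) \<Rightarrow> bool" where
  "adjoint_solution \<epsilon> B W f \<longleftrightarrow> smooth_on W f \<and>
     (\<forall>p\<in>W. Dt f p = - \<epsilon> * Dx (Dx f) p + B p * Dx f p)"

text \<open>
  Second-order jets \<open>(t, x, u, u\<^sub>t, u\<^sub>x, u\<^sub>t\<^sub>t, u\<^sub>t\<^sub>x, u\<^sub>x\<^sub>x)\<close>. An equation is identified with the subset of
  the jet space that it defines; in \<open>FP_equation\<close> the term \<open>(B u)\<^sub>x\<close> is expanded by the product rule.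
\<close>

type_synonym jet = "real \<times> real \<times> real \<times> real \<times> real \<times> real \<times> real \<times> real"

fun jet2 :: "(real \<times> real \<Rightarrow> real) \<Rightarrow> real \<times> real \<Rightarrow> jet" where
  "jet2 f (t, x) =
     (t, x, f (t, x), Dt f (t, x), Dx f (t, x), Dt (Dt f) (t, x), Dt (Dx f) (t, x), Dx (Dx f) (t, x))"

type_synonym drift = "(real \<times> real) set \<times> (real \<times> real \<Rightarrow> real)"

definition is_drift :: "drift \<Rightarrow> bool" where
  "is_drift = (\<lambda>(D, B). open D \<and> smooth_on D B)"

definition FP_equation :: "real \<Rightarrow> drift \<Rightarrow> jet set" where
  "FP_equation \<epsilon> = (\<lambda>(D, B). {(t, x, u, ut, ux, utt, utx, uxx).
     (t, x) \<in> D \<and> ut = \<epsilon> * uxx + B (t, x) * ux + Dx B (t, x) * u})"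

type_synonym transformation =
  "(real \<times> real \<times> real) set \<times> (real \<times> real \<times> real \<Rightarrow> real \<times> real \<times> real)"

definition is_point_transformation :: "transformation \<Rightarrow> bool" where
  "is_point_transformation = (\<lambda>(\<Omega>, \<Phi>). open \<Omega> \<and>
     (\<forall>z\<in>\<Omega>. \<exists>V \<Psi>. open V \<and> z \<in> V \<and> V \<subseteq> \<Omega> \<and> open (\<Phi> ` V) \<and>
        smooth_on V \<Phi> \<and> smooth_on (\<Phi> ` V) \<Psi> \<and> (\<forall>w\<in>V. \<Psi> (\<Phi> w) = w)))"

fun base :: "real \<times> real \<times> real \<Rightarrow> real \<times> real" where
  "base (t, x, u) = (t, x)"

fun graph_pt :: "(real \<times> real \<Rightarrow> real) \<Rightarrow> real \<times> real \<Rightarrow> real \<times> real \<times> real" where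
  "graph_pt f (t, x) = (t, x, f (t, x))"

text \<open>
  The second prolongation of \<open>\<Phi>\<close>, as a relation: the jet of \<open>f\<close> at \<open>p\<close> goes to the jet of \<open>g\<close> at \<open>q\<close>
  if \<open>\<Phi>\<close> maps the graph of \<open>f\<close> near \<open>p\<close> into the graph of \<open>g\<close>. Jets of functions whose image under
  \<open>\<Phi>\<close> is not locally the graph of a smooth function are outside the domain of the relation. The
  functions \<open>f\<close> and \<open>g\<close> merely represent jets and are not required to solve anything.
\<close>

definition prolongation :: "transformation \<Rightarrow> (jet \<times> jet) set" where
  "prolongation = (\<lambda>(\<Omega>, \<Phi>). {(jet2 f p, jet2 g q) | f p g q. \<exists>N M.
     open N \<and> p \<in> N \<and> smooth_on N f \<and> open M \<and> smooth_on M g \<and>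
     (\<forall>s\<in>N. graph_pt f s \<in> \<Omega> \<and> (\<exists>r\<in>M. \<Phi> (graph_pt f s) = graph_pt g r)) \<and>
     q \<in> M \<and> \<Phi> (graph_pt f p) = graph_pt g q})"

definition maps_equation :: "transformation \<Rightarrow> jet set \<Rightarrow> jet set \<Rightarrow> bool" where
  "maps_equation \<tau> E E' \<longleftrightarrow> (\<forall>(j, j') \<in> prolongation \<tau>. j \<in> E \<longleftrightarrow> j' \<in> E')"

definition equivalence_groupoid :: "real \<Rightarrow> (drift \<times> transformation \<times> drift) set" where
  "equivalence_groupoid \<epsilon> = {((D, B), (\<Omega>, \<Phi>), (D', B')).
     is_drift (D, B) \<and> is_drift (D', B') \<and> is_point_transformation (\<Omega>, \<Phi>) \<and>
     base ` \<Omega> \<subseteq> D \<and> base ` \<Phi> ` \<Omega> \<subseteq> D' \<and>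
     maps_equation (\<Omega>, \<Phi>) (FP_equation \<epsilon> (D, B)) (FP_equation \<epsilon> (D', B'))}"

text \<open>
  Conditions on the shape of a transformation domain under which functions that depend locally only
  on \<open>t\<close> (or only on \<open>(t, x)\<close>) are single-valued functions of \<open>t\<close> (of \<open>(t, x)\<close>). Every open box is
  of this kind, hence so is a suitable neighbourhood of any point of an arbitrary domain.
\<close>

definition connected_slices :: "(real \<times> real \<times> real) set \<Rightarrow> bool" where
  "connected_slices \<Omega> \<longleftrightarrow>
     (\<forall>t. connected {(x, u). (t, x, u) \<in> \<Omega>}) \<and> (\<forall>t x. connected {u. (t, x, u) \<in> \<Omega>})"

text \<open>
  The normal form of the admissible transformations with source drift \<open>B\<close> and target drift \<open>(D', B')\<close>.
  Since \<open>u \<mapsto> U\<^sup>1 u + U\<^sup>0\<close> is the addition of \<open>U\<^sup>0 / U\<^sup>1\<close> followed by multiplication by \<open>U\<^sup>1\<close>, it is the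
  quotient \<open>U\<^sup>0 / U\<^sup>1\<close> that has to solve the source equation, not \<open>U\<^sup>0\<close> itself: for \<open>\<epsilon> = 1\<close>, \<open>B = 0\<close>,
  \<open>T = t\<close>, \<open>X\<^sup>1 = 1\<close>, \<open>X\<^sup>0 = 0\<close>, \<open>U\<^sup>1 = exp (x - t)\<close> the target drift is \<open>- 2\<close>, and the zero solution
  goes to \<open>U\<^sup>0\<close>, which for \<open>U\<^sup>0 = x\<close> solves the source equation but not the target one.
\<close>

definition admissible_form ::
  "real \<Rightarrow> (real \<times> real \<Rightarrow> real) \<Rightarrow> transformation \<Rightarrow> drift \<Rightarrow>
   (real \<Rightarrow> real) \<Rightarrow> (real \<Rightarrow> real) \<Rightarrow> (real \<Rightarrow> real) \<Rightarrow>
   (real \<times> real \<Rightarrow> real) \<Rightarrow> (real \<times> real \<Rightarrow> real) \<Rightarrow> bool" where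
  "admissible_form \<epsilon> B = (\<lambda>(\<Omega>, \<Phi>) (D', B') T X1 X0 U1 U0.
     smooth_on (fst ` \<Omega>) T \<and> smooth_on (fst ` \<Omega>) X1 \<and> smooth_on (fst ` \<Omega>) X0 \<and>
     smooth_on (base ` \<Omega>) U1 \<and> smooth_on (base ` \<Omega>) U0 \<and>
     (\<forall>(t, x, u) \<in> \<Omega>. \<Phi> (t, x, u) = (T t, X1 t * x + X0 t, U1 (t, x) * u + U0 (t, x))) \<and>
     (\<forall>t \<in> fst ` \<Omega>. X1 t \<noteq> 0 \<and> deriv T t = (X1 t)\<^sup>2) \<and>
     (\<forall>(t, x) \<in> base ` \<Omega>. X1 t * U1 (t, x) \<noteq> 0) \<and>
     adjoint_solution \<epsilon> B (base ` \<Omega>) (\<lambda>(t, x). X1 t * U1 (t, x)) \<and>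
     FP_solution \<epsilon> B (base ` \<Omega>) (\<lambda>p. U0 p / U1 p) \<and>
     (\<forall>(t, x) \<in> base ` \<Omega>. (T t, X1 t * x + X0 t) \<in> D' \<and>
        B' (T t, X1 t * x + X0 t) =
          1 / X1 t * (B (t, x) - 2 * \<epsilon> * (Dx U1 (t, x) / U1 (t, x)))
          - (deriv X1 t * x + deriv X0 t) / (X1 t)\<^sup>2))"

end

theory Submission
  imports Defs
begin

text \<open>
  Necessity: a local diffeomorphism \<open>\<Phi>\<close> carries the graph of a quadratic function with prescribed
  2-jet to the graph of a smooth function, as long as the total Jacobian of the base components does
  not vanish on the 1-jet. Comparing the images of suitably chosen jets of solutions determines the
  shape of \<open>\<Phi>\<close>. Jets differing only in \<open>u\<^sub>t\<^sub>t\<close> give \<open>T\<^sub>x = T\<^sub>u = 0\<close>; jets differing by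
  \<open>(\<epsilon>, 1)\<close> in \<open>(u\<^sub>t, u\<^sub>x\<^sub>x)\<close> give \<open>(X\<^sub>x + u\<^sub>x X\<^sub>u)\<^sup>2 = T\<^sub>t\<close> whenever the left side is
  nonzero, so \<open>X\<^sub>u = 0\<close> and \<open>X\<^sub>x\<^sup>2 = T\<^sub>t\<close>; and the dependence on \<open>u\<^sub>x\<close> alone gives
  \<open>U\<^sub>u\<^sub>u = 0\<close>.

  For \<open>\<Phi>\<close> of this shape the pulled-back target equation is a multiple of the source equation plus a
  remainder that is affine in \<open>(u\<^sub>x, u)\<close>. The coefficient of \<open>u\<^sub>x\<close> vanishes iff the drifts are
  related as claimed; given that, the coefficient of \<open>u\<close> vanishes iff \<open>X\<^sup>1 U\<^sup>1\<close> solves the adjoint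
  equation, and then the free term vanishes iff \<open>U\<^sup>0 / U\<^sup>1\<close> solves the source equation.
\<close>

section \<open>Calculus of smooth functions\<close>

text \<open>\<open>maps_equation\<close> compares the equations jet by jet, so a solution jet is any
  jet lying on the equation. The obstacle is that \<open>prolongation\<close> is a relation between
  representing functions: a jet has an image only if the image of a graph is again a graph, of a
  smooth function. The total Jacobian and a smooth inverse function theorem in the plane secure
  this. The image g itself is never computed in closed form: g(T, X) = U holds on the graph, and
  differentiating this twice along lifted straight lines gives relations in which the derivatives of
  g occur linearly.

  The comparisons succeed because the target equation, whatever its drift, ties g_t, g_x, g_xx to
  the value of g at the image point. Thus two images over the same point with equal first
  derivatives have equal g_xx, and images differing only in g_t among their first derivatives differ
  in g_xx by a known multiple. A difference in the second derivatives of the source jets must be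
  visible in the image, since no image graph is tangent to the image of the u-direction.\<close>

abbreviation dir :: "'a::real_normed_vector \<Rightarrow> ('a \<Rightarrow> 'b::real_normed_vector) \<Rightarrow> 'a \<Rightarrow> 'b" where
  "dir v f \<equiv> (\<lambda>p. frechet_derivative f (at p) v)"

section \<open>Closure properties of C^k functions on open sets\<close>

lemma Ck_on_cong:
  assumes "open S" "\<And>p. p \<in> S \<Longrightarrow> f p = g p" "Ck_on S f k"
  shows "Ck_on S g k"
  using assms(2,3)
proof (induction k arbitrary: f g)
  case 0
  then show ?case by (simp cong: continuous_on_cong)
next
  case (Suc k)
  have *: "(g has_derivative frechet_derivative f (at p)) (at p)" if "p \<in> S" for p
    using Suc.prems that \<open>open S\<close>
    by (intro has_derivative_transform_within_open[of f _ p UNIV S g]) (simp_all add: frechet_derivative_works)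
  have eq: "frechet_derivative f (at p) = frechet_derivative g (at p)" if "p \<in> S" for p
    using frechet_derivative_at[OF *[OF that]] .
  have "Ck_on S (dir v g) k" for v
    by (rule Suc.IH[of "dir v f"]) (use Suc.prems eq in simp_all)
  moreover have "g differentiable (at p)" if "p \<in> S" for p
    using *[OF that] by (auto simp: differentiable_def)
  ultimately show ?case by simp
qed

lemma Ck_on_subset: "Ck_on S f k \<Longrightarrow> V \<subseteq> S \<Longrightarrow> Ck_on V f k"
  by (induction k arbitrary: f) (auto intro: continuous_on_subset)

text \<open>By uniqueness of the Frechet derivative, any pointwise derivative formula may stand in
  for \<open>frechet_derivative\<close>. The inductions on \<open>k\<close> below use this rule to
  reduce a claim to the terms of such a formula.\<close>

lemma Ck_on_SucI:
  assumes "open S" "\<And>p. p \<in> S \<Longrightarrow> (f has_derivative f' p) (at p)" "\<And>v. Ck_on S (\<lambda>p. f' p v) k"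
  shows "Ck_on S f (Suc k)"
proof -
  have eq: "f' p = frechet_derivative f (at p)" if "p \<in> S" for p
    using frechet_derivative_at[OF assms(2)[OF that]] .
  have "Ck_on S (dir v f) k" for v
    by (rule Ck_on_cong[OF assms(1) _ assms(3)[of v]]) (simp add: eq)
  moreover have "f differentiable (at p)" if "p \<in> S" for p
    using assms(2)[OF that] by (auto simp: differentiable_def)
  ultimately show ?thesis by simp
qed

lemma Ck_on_Suc_has_derivative:
  "Ck_on S f (Suc k) \<Longrightarrow> p \<in> S \<Longrightarrow> (f has_derivative frechet_derivative f (at p)) (at p)"
  by (simp add: frechet_derivative_works)

text \<open>Product and chain rules keep undifferentiated factors, so the induction steps need those
  factors one order lower.\<close>

lemma Ck_on_SucD: "Ck_on S f (Suc k) \<Longrightarrow> Ck_on S f k"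
proof (induction k arbitrary: f)
  case 0
  then show ?case
    by (auto intro!: continuous_at_imp_continuous_on differentiable_imp_continuous_within)
next
  case (Suc k)
  have "Ck_on S (dir v f) k" for v
    by (rule Suc.IH) (use Suc.prems in \<open>unfold Ck_on.simps(2)[of S f "Suc k"], blast\<close>)
  then show ?case
    using Suc.prems unfolding Ck_on.simps(2)[of S f] by blast
qed

text \<open>A point transformation is given as smooth only near each point; this glues the local
  statements over the whole domain.\<close>

lemma Ck_on_local:
  assumes "\<And>p. p \<in> S \<Longrightarrow> \<exists>V. open V \<and> p \<in> V \<and> Ck_on (V \<inter> S) f k" "open S"
  shows "Ck_on S f k"
  using assms(1)
proof (induction k arbitrary: f)
  case 0
  have "isCont f p" if p: "p \<in> S" for p
  proof -
    obtain V where V: "open V" "p \<in> V" "continuous_on (V \<inter> S) f" using 0 p by auto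
    then show ?thesis using p \<open>open S\<close> continuous_on_eq_continuous_at[of "V \<inter> S" f] by auto
  qed
  then show ?case by (simp add: continuous_at_imp_continuous_on)
next
  case (Suc k)
  have "Ck_on S (dir v f) k" for v
    by (rule Suc.IH) (use Suc.prems in force)
  moreover have "f differentiable (at p)" if "p \<in> S" for p
    using Suc.prems[OF that] that by force
  ultimately show ?case by simp
qed

lemma Ck_on_const: "Ck_on S (\<lambda>p. c) k"
  by (induction k arbitrary: c) auto

lemma Ck_on_bounded_linear_comp:
  assumes "open S" "bounded_linear L" "Ck_on S f k"
  shows "Ck_on S (\<lambda>p. L (f p)) k"
  using assms(3)
proof (induction k arbitrary: f)
  case 0
  then show ?case using bounded_linear.continuous_on[OF assms(2)] by simp
next
  case (Suc k)
  have D: "Ck_on S (dir v f) k" for v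
    using Suc.prems by simp
  show ?case
    by (rule Ck_on_SucI[OF assms(1) bounded_linear.has_derivative[OF assms(2) Ck_on_Suc_has_derivative[OF Suc.prems]]])
      (assumption+, intro Suc.IH D)
qed

lemma Ck_on_add:
  assumes "open S" "Ck_on S f k" "Ck_on S g k"
  shows "Ck_on S (\<lambda>p. f p + g p) k"
  using assms(2,3)
proof (induction k arbitrary: f g)
  case 0
  then show ?case by (auto intro: continuous_intros)
next
  case (Suc k)
  have D: "Ck_on S (dir v f) k" "Ck_on S (dir v g) k" for v
    using Suc.prems by simp_all
  show ?case
    by (rule Ck_on_SucI[OF assms(1) has_derivative_add[OF Ck_on_Suc_has_derivative[OF Suc.prems(1)] Ck_on_Suc_has_derivative[OF Suc.prems(2)]]])
      (assumption+, intro assms(1) Suc.IH D)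
qed

lemma Ck_on_sum:
  assumes "open S" "\<And>i. i \<in> I \<Longrightarrow> Ck_on S (f i) k"
  shows "Ck_on S (\<lambda>p. \<Sum>i\<in>I. f i p) k"
  using assms(2)
proof (induction I rule: infinite_finite_induct)
  case (insert i I)
  have "Ck_on S (\<lambda>p. f i p + (\<Sum>i\<in>I. f i p)) k"
    by (rule Ck_on_add[OF assms(1)]) (use insert in simp_all)
  then show ?case using insert by simp
qed (simp_all add: Ck_on_const)

lemma Ck_on_bilinear:
  assumes "open S" "bounded_bilinear b" "Ck_on S f k" "Ck_on S g k"
  shows "Ck_on S (\<lambda>p. b (f p) (g p)) k"
  using assms(3,4)
proof (induction k arbitrary: f g)
  case 0
  then show ?case using bounded_bilinear.continuous_on[OF assms(2)] by simp
next
  case (Suc k)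
  have D: "Ck_on S (dir v f) k" "Ck_on S (dir v g) k" for v
    using Suc.prems by simp_all
  show ?case
    by (rule Ck_on_SucI[OF assms(1) bounded_bilinear.FDERIV[OF assms(2) Ck_on_Suc_has_derivative[OF Suc.prems(1)] Ck_on_Suc_has_derivative[OF Suc.prems(2)]]])
      (assumption+, intro Ck_on_add assms(1) Suc.IH Ck_on_SucD[OF Suc.prems(1)] Ck_on_SucD[OF Suc.prems(2)] D)
qed

lemma linear_euclidean_sum:
  fixes L :: "'b::euclidean_space \<Rightarrow> 'c::real_vector"
  assumes "linear L"
  shows "L w = (\<Sum>b\<in>Basis. (w \<bullet> b) *\<^sub>R L b)"
proof -
  have "L w = L (\<Sum>b\<in>Basis. (w \<bullet> b) *\<^sub>R b)" by (simp add: euclidean_representation)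
  also have "\<dots> = (\<Sum>b\<in>Basis. (w \<bullet> b) *\<^sub>R L b)"
    by (simp add: linear_sum[OF assms] linear_cmul[OF assms])
  finally show ?thesis .
qed

text \<open>\<open>Ck_on\<close> controls derivatives in fixed directions only, but the chain rule
  differentiates \<open>g\<close> in the moving direction
  \<open>frechet_derivative f (at p) v\<close>. Expanding that direction in a basis leaves fixed
  directions with C^k coefficients.\<close>

lemma Ck_on_compose:
  fixes f :: "'a::real_normed_vector \<Rightarrow> 'b::euclidean_space"
  assumes "open S" "f ` S \<subseteq> T" "Ck_on S f k" "Ck_on T g k"
  shows "Ck_on S (\<lambda>p. g (f p)) k"
  using assms(3,4)
proof (induction k arbitrary: g)
  case 0
  then show ?case using continuous_on_compose2[OF 0(2)[simplified] 0(1)[simplified] assms(2)] by simp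
next
  case (Suc k)
  have D: "Ck_on S (dir v f) k" "Ck_on T (dir w g) k" for v w
    using Suc.prems by simp_all
  let ?D = "\<lambda>g p. frechet_derivative g (at p)"
  have der: "((\<lambda>p. g (f p)) has_derivative (\<lambda>v. \<Sum>b\<in>Basis. (?D f p v \<bullet> b) *\<^sub>R ?D g (f p) b)) (at p)"
    if "p \<in> S" for p
  proof -
    have "(g has_derivative ?D g (f p)) (at (f p))"
      using Ck_on_Suc_has_derivative[OF Suc.prems(2)] that assms(2) by blast
    note g = this
    have "((\<lambda>p. g (f p)) has_derivative (\<lambda>v. ?D g (f p) (?D f p v))) (at p)"
      by (rule has_derivative_compose[OF Ck_on_Suc_has_derivative[OF Suc.prems(1) that] g])
    also have "(\<lambda>v. ?D g (f p) (?D f p v)) = (\<lambda>v. \<Sum>b\<in>Basis. (?D f p v \<bullet> b) *\<^sub>R ?D g (f p) b)"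
      by (rule ext, rule linear_euclidean_sum[OF has_derivative_linear[OF g]])
    finally show ?thesis .
  qed
  have "Ck_on S (\<lambda>p. (dir v f p \<bullet> b) *\<^sub>R dir b g (f p)) k" for v b
    by (rule Ck_on_bilinear[OF assms(1) bounded_bilinear_scaleR
          Ck_on_bounded_linear_comp[OF assms(1) bounded_linear_inner_left D(1)]
          Suc.IH[OF Ck_on_SucD[OF Suc.prems(1)] D(2)]])
  then show ?case
    by (intro Ck_on_SucI[OF assms(1) der] Ck_on_sum[OF assms(1)])
qed

text \<open>The derivative of 1/f is built from f' and 1/f itself, and the latter is C^k by the
  induction hypothesis.\<close>

lemma Ck_on_inverse:
  fixes f :: "'a::real_normed_vector \<Rightarrow> real"
  assumes "open S" "\<And>p. p \<in> S \<Longrightarrow> f p \<noteq> 0" "Ck_on S f k"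
  shows "Ck_on S (\<lambda>p. inverse (f p)) k"
  using assms(3)
proof (induction k)
  case 0
  then show ?case using assms(2) by (auto intro: continuous_intros)
next
  case (Suc k)
  have D: "Ck_on S (dir v f) k" for v
    using Suc.prems by simp
  have I: "Ck_on S (\<lambda>p. inverse (f p)) k"
    using Suc.IH Ck_on_SucD[OF Suc.prems] .
  note M = Ck_on_bilinear[OF assms(1) bounded_bilinear_mult]
  show ?case
    by (rule Ck_on_SucI[OF assms(1) Deriv.has_derivative_inverse[OF assms(2) Ck_on_Suc_has_derivative[OF Suc.prems]]])
      (assumption+, rule Ck_on_bounded_linear_comp[OF assms(1) bounded_linear_minus[OF bounded_linear_ident]
        M[OF M[OF I D] I]])
qed

lemma Ck_on_Pair:
  assumes "open S" "Ck_on S f k" "Ck_on S g k"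
  shows "Ck_on S (\<lambda>p. (f p, g p)) k"
  using assms(2,3)
proof (induction k arbitrary: f g)
  case 0
  then show ?case by (auto intro: continuous_intros)
next
  case (Suc k)
  have D: "Ck_on S (dir v f) k" "Ck_on S (dir v g) k" for v
    using Suc.prems by simp_all
  show ?case
    by (rule Ck_on_SucI[OF assms(1) has_derivative_Pair[OF Ck_on_Suc_has_derivative[OF Suc.prems(1)] Ck_on_Suc_has_derivative[OF Suc.prems(2)]]])
      (assumption+, intro assms(1) Suc.IH D)
qed

section \<open>Closure properties of smooth functions\<close>

lemma smooth_on_cong: "open S \<Longrightarrow> (\<And>p. p \<in> S \<Longrightarrow> f p = g p) \<Longrightarrow> smooth_on S f \<Longrightarrow> smooth_on S g"
  by (auto simp: smooth_on_def intro: Ck_on_cong)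

lemma smooth_on_subset: "smooth_on S f \<Longrightarrow> V \<subseteq> S \<Longrightarrow> smooth_on V f"
  by (auto simp: smooth_on_def intro: Ck_on_subset)

lemma smooth_on_local:
  assumes "open S" "\<And>p. p \<in> S \<Longrightarrow> \<exists>V. open V \<and> p \<in> V \<and> smooth_on (V \<inter> S) f"
  shows "smooth_on S f"
  unfolding smooth_on_def using assms by (auto simp: smooth_on_def intro!: Ck_on_local)

lemma smooth_on_dir: "smooth_on S f \<Longrightarrow> smooth_on S (dir v f)"
  unfolding smooth_on_def using Ck_on.simps(2)[of S f] by blast

lemma smooth_on_has_derivative:
  "smooth_on S f \<Longrightarrow> p \<in> S \<Longrightarrow> (f has_derivative frechet_derivative f (at p)) (at p)"
  unfolding smooth_on_def using Ck_on_Suc_has_derivative[of S f 0 p] by blast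

lemma smooth_on_continuous: "smooth_on S f \<Longrightarrow> continuous_on S f"
  unfolding smooth_on_def using Ck_on.simps(1)[of S f] by blast

lemma smooth_on_const: "smooth_on S (\<lambda>p. c)"
  by (simp add: smooth_on_def Ck_on_const)

lemma smooth_on_linear_comp:
  "open S \<Longrightarrow> bounded_linear L \<Longrightarrow> smooth_on S f \<Longrightarrow> smooth_on S (\<lambda>p. L (f p))"
  by (simp add: smooth_on_def Ck_on_bounded_linear_comp)

lemma smooth_on_ident: "open S \<Longrightarrow> smooth_on S (\<lambda>p. p)"
  unfolding smooth_on_def
proof
  fix k assume "open S"
  then show "Ck_on S (\<lambda>p. p) k"
    by (cases k) (auto intro!: Ck_on_SucI[OF _ has_derivative_ident] Ck_on_const simp del: Ck_on.simps(2))
qed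

lemma smooth_on_add: "open S \<Longrightarrow> smooth_on S f \<Longrightarrow> smooth_on S g \<Longrightarrow> smooth_on S (\<lambda>p. f p + g p)"
  by (simp add: smooth_on_def Ck_on_add)

lemma smooth_on_minus: "open S \<Longrightarrow> smooth_on S f \<Longrightarrow> smooth_on S (\<lambda>p. - f p)"
  using smooth_on_linear_comp[OF _ bounded_linear_minus[OF bounded_linear_ident]] by auto

lemma smooth_on_diff: "open S \<Longrightarrow> smooth_on S f \<Longrightarrow> smooth_on S g \<Longrightarrow> smooth_on S (\<lambda>p. f p - g p)"
  using smooth_on_add[of S f "\<lambda>p. - g p"] smooth_on_minus[of S g] by simp

lemma smooth_on_mult:
  fixes f g :: "'a::real_normed_vector \<Rightarrow> real"
  shows "open S \<Longrightarrow> smooth_on S f \<Longrightarrow> smooth_on S g \<Longrightarrow> smooth_on S (\<lambda>p. f p * g p)"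
  by (simp add: smooth_on_def Ck_on_bilinear[OF _ bounded_bilinear_mult])

lemma smooth_on_power:
  fixes f :: "'a::real_normed_vector \<Rightarrow> real"
  shows "open S \<Longrightarrow> smooth_on S f \<Longrightarrow> smooth_on S (\<lambda>p. f p ^ n)"
  by (induction n) (auto intro: smooth_on_const smooth_on_mult)

lemma smooth_on_divide:
  fixes f g :: "'a::real_normed_vector \<Rightarrow> real"
  shows "open S \<Longrightarrow> smooth_on S f \<Longrightarrow> smooth_on S g \<Longrightarrow> (\<And>p. p \<in> S \<Longrightarrow> g p \<noteq> 0) \<Longrightarrow> smooth_on S (\<lambda>p. f p / g p)"
  unfolding divide_inverse
  by (simp add: smooth_on_def Ck_on_bilinear[OF _ bounded_bilinear_mult] Ck_on_inverse)

lemma smooth_on_compose: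
  fixes f :: "'a::real_normed_vector \<Rightarrow> 'b::euclidean_space"
  shows "open S \<Longrightarrow> smooth_on T g \<Longrightarrow> f ` S \<subseteq> T \<Longrightarrow> smooth_on S f \<Longrightarrow> smooth_on S (\<lambda>p. g (f p))"
  unfolding smooth_on_def by (intro allI, rule Ck_on_compose) auto

lemma smooth_on_Pair: "open S \<Longrightarrow> smooth_on S f \<Longrightarrow> smooth_on S g \<Longrightarrow> smooth_on S (\<lambda>p. (f p, g p))"
  by (simp add: smooth_on_def Ck_on_Pair)

lemma smooth_on_fst: "open S \<Longrightarrow> smooth_on S f \<Longrightarrow> smooth_on S (\<lambda>p. fst (f p))"
  by (rule smooth_on_linear_comp[OF _ bounded_linear_fst])

lemma smooth_on_snd: "open S \<Longrightarrow> smooth_on S f \<Longrightarrow> smooth_on S (\<lambda>p. snd (f p))"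
  by (rule smooth_on_linear_comp[OF _ bounded_linear_snd])

lemmas smooth_intros = smooth_on_const smooth_on_ident smooth_on_add smooth_on_minus smooth_on_diff
  smooth_on_mult smooth_on_power smooth_on_divide smooth_on_Pair smooth_on_fst smooth_on_snd

text \<open>The inverse function theorem gives a differentiable inverse \<open>h\<close> whose
  derivative at \<open>y\<close> inverts the Jacobian matrix at \<open>h y\<close>. By Cramer's rule
  its entries are smooth functions of \<open>h y\<close>, so if \<open>h\<close> is C^k then so is
  its derivative: a bootstrap from continuity to every order.\<close>

lemma smooth_inverse_function_2:
  fixes F :: "real \<times> real \<Rightarrow> real \<times> real"
  assumes S: "open S" "p \<in> S" and F: "smooth_on S F"
    and det: "fst (dir (1,0) F p) * snd (dir (0,1) F p) - fst (dir (0,1) F p) * snd (dir (1,0) F p) \<noteq> 0"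
  obtains N M h where "open N" "p \<in> N" "N \<subseteq> S" "open M" "F ` N = M" "smooth_on M h"
    "\<And>s. s \<in> N \<Longrightarrow> h (F s) = s" "h ` M = N" "\<And>r. r \<in> M \<Longrightarrow> F (h r) = r"
proof -
  define a1 b1 a2 b2 where "a1 = (\<lambda>q. fst (dir (1,0) F q))" and "b1 = (\<lambda>q. snd (dir (1,0) F q))"
    and "a2 = (\<lambda>q. fst (dir (0,1) F q))" and "b2 = (\<lambda>q. snd (dir (0,1) F q))"
  note ab = a1_def a2_def b1_def b2_def
  define \<Delta> where "\<Delta> q = a1 q * b2 q - a2 q * b1 q" for q
  \<comment> \<open>Cramer's rule for the inverse of the derivative of \<open>F\<close> at
    \<open>q\<close>.\<close>
  define R where "R q w = ((fst w * b2 q - snd w * a2 q) / \<Delta> q, (snd w * a1 q - fst w * b1 q) / \<Delta> q)" for q and w :: "real \<times> real"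
  have sm: "smooth_on S a1" "smooth_on S a2" "smooth_on S b1" "smooth_on S b2" "smooth_on S \<Delta>"
    unfolding ab \<Delta>_def by (intro smooth_intros smooth_on_dir F S(1))+
  have DF: "(F has_derivative frechet_derivative F (at q)) (at q)" if "q \<in> S" for q
    using smooth_on_has_derivative[OF F that] .
  have DFv: "dir v F q = (fst v * a1 q + snd v * a2 q, fst v * b1 q + snd v * b2 q)" if "q \<in> S" for q v
  proof -
    have "linear (frechet_derivative F (at q))" using DF[OF that] by (rule has_derivative_linear)
    from linear_euclidean_sum[OF this, of v] show ?thesis
      by (cases v) (auto simp: Basis_prod_def ab prod_eq_iff)
  qed
  have RF: "R q (dir v F q) = v" if "q \<in> S" "\<Delta> q \<noteq> 0" for q v
  proof -
    have "(fst v * a1 q + snd v * a2 q) * b2 q - (fst v * b1 q + snd v * b2 q) * a2 q = fst v * \<Delta> q"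
      "(fst v * b1 q + snd v * b2 q) * a1 q - (fst v * a1 q + snd v * a2 q) * b1 q = snd v * \<Delta> q"
      unfolding \<Delta>_def by algebra+
    then show ?thesis using that by (simp add: R_def DFv prod_eq_iff)
  qed
  have linR: "bounded_linear (R q)" for q
    unfolding R_def
    by (intro bounded_linear_Pair bounded_linear_divide bounded_linear_compose[OF bounded_linear_divide]
          bounded_linear_sub bounded_linear_mult_const bounded_linear_fst bounded_linear_snd)
  \<comment> \<open>Restricting to a nonvanishing determinant makes \<open>R\<close> an inverse at
    every point reached by \<open>h\<close>, not just at \<open>p\<close>.\<close>
  define S' where "S' = {q\<in>S. \<Delta> q \<noteq> 0}"
  have S': "open S'" "p \<in> S'" "S' \<subseteq> S"
    unfolding S'_def
    using continuous_open_preimage[OF smooth_on_continuous[OF sm(5)] S(1), of "-{0}"] S det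
    by (auto simp: \<Delta>_def ab vimage_def Int_def conj_commute)
  \<comment> \<open>The inverse function theorem wants the derivative as a continuous map into
    bounded operators; in finite dimension, continuity in each fixed direction gives this.\<close>
  define f' where "f' q = Blinfun (frechet_derivative F (at q))" for q
  have f': "blinfun_apply (f' q) = frechet_derivative F (at q)" if "q \<in> S" for q
    unfolding f'_def using bounded_linear_Blinfun_apply has_derivative_bounded_linear DF[OF that] by blast
  have contf: "continuous_on S' f'"
  proof (rule continuous_on_blinfun_componentwise)
    fix i :: "real \<times> real"
    have "continuous_on S' (dir i F)"
      using smooth_on_continuous[OF smooth_on_dir[OF F]] S'(3) continuous_on_subset by blast
    then show "continuous_on S' (\<lambda>x. blinfun_apply (f' x) i)"
      by (rule continuous_on_eq) (use f' S' in auto)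
  qed
  have derF: "(F has_derivative blinfun_apply (f' q)) (at q)" if "q \<in> S'" for q
    using DF[of q] f'[of q] S'(3) that by auto
  have inv: "Blinfun (R p) o\<^sub>L f' p = id_blinfun"
    by (rule blinfun_eqI) (use S S' RF in \<open>auto simp: bounded_linear_Blinfun_apply linR f' S'_def\<close>)
  have "\<exists>N M h h'. open N \<and> N \<subseteq> S' \<and> p \<in> N \<and> open M \<and> F p \<in> M \<and> homeomorphism N M F h \<and>
    (\<forall>y\<in>M. (h has_derivative h' y) (at y)) \<and> (\<forall>y\<in>M. h' y = Hilbert_Choice.inv (blinfun_apply (f' (h y)))) \<and>
    (\<forall>y\<in>M. bij (blinfun_apply (f' (h y))))"
    by (rule inverse_function_theorem[OF S'(1) derF contf S'(2) inv], assumption) blast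
  then obtain N M h h' where N: "open N" "N \<subseteq> S'" "p \<in> N" "open M" "F p \<in> M" "homeomorphism N M F h"
    and dh: "\<And>y. y \<in> M \<Longrightarrow> (h has_derivative h' y) (at y)"
    and h': "\<And>y. y \<in> M \<Longrightarrow> h' y = Hilbert_Choice.inv (blinfun_apply (f' (h y)))"
    and bij: "\<And>y. y \<in> M \<Longrightarrow> bij (blinfun_apply (f' (h y)))"
    by blast
  have hM: "h ` M = N" "continuous_on M h" using N(6) by (auto simp: homeomorphism_def)
  \<comment> \<open>The theorem describes \<open>h'\<close> only as an abstract inverse function;
    this identifies it with the explicit formula that the bootstrap differentiates.\<close>
  have hR: "h' y v = R (h y) v" if "y \<in> M" for y v
  proof -
    have "h y \<in> S" "\<Delta> (h y) \<noteq> 0" using hM N(2) that by (auto simp: S'_def)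
    then have "R (h y) (blinfun_apply (f' (h y)) (h' y v)) = h' y v" using RF f' by simp
    moreover have "blinfun_apply (f' (h y)) (h' y v) = v"
      unfolding h'[OF that] using bij[OF that] by (simp add: bij_is_surj surj_f_inv_f)
    ultimately show ?thesis by simp
  qed
  have "Ck_on M h k" for k
  proof (induction k)
    case 0
    then show ?case using hM by simp
  next
    case (Suc k)
    have "Ck_on M (\<lambda>y. c (h y)) k" if "smooth_on S c" for c :: "real \<times> real \<Rightarrow> real"
      using Ck_on_compose[OF N(4) _ Suc.IH, of S c] hM N(2) S'(3) that by (auto simp: smooth_on_def)
    note C = this[OF sm(1)] this[OF sm(2)] this[OF sm(3)] this[OF sm(4)] this[OF sm(5)]
    have nz: "\<Delta> (h y) \<noteq> 0" if "y \<in> M" for y using hM N(2) that by (auto simp: S'_def)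
    have Cm: "Ck_on M (\<lambda>y. w * c y - u * d y) k" if "Ck_on M c k" "Ck_on M d k" for c d :: "real \<times> real \<Rightarrow> real" and w u :: real
    proof -
      have "Ck_on M (\<lambda>y. w * c y + (- u) * d y) k"
        by (intro Ck_on_add Ck_on_bilinear[OF _ bounded_bilinear_mult] Ck_on_const that N(4))
      then show ?thesis by simp
    qed
    have "Ck_on M (\<lambda>y. h' y v) k" for v
    proof (rule Ck_on_cong[OF N(4)])
      show "Ck_on M (\<lambda>y. R (h y) v) k"
        unfolding R_def divide_inverse
        by (intro Ck_on_Pair Ck_on_bilinear[OF _ bounded_bilinear_mult] Ck_on_inverse Cm C N(4) nz)
    qed (simp add: hR)
    then show ?case using Ck_on_SucI[OF N(4) dh] by blast
  qed
  then have "smooth_on M h" by (simp add: smooth_on_def)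
  then show ?thesis
    using that[of N M h] N S' by (auto simp: homeomorphism_def)
qed

section \<open>Partial derivatives and derivatives along curves\<close>

lemma linear_pair:
  fixes L :: "real \<times> real \<Rightarrow> 'c::real_vector"
  assumes "linear L"
  shows "L (a, b) = a *\<^sub>R L (1, 0) + b *\<^sub>R L (0, 1)"
  using linear_euclidean_sum[OF assms, of "(a, b)"] by (simp add: Basis_prod_def)

lemma linear_triple:
  fixes L :: "real \<times> real \<times> real \<Rightarrow> 'c::real_vector"
  assumes "linear L"
  shows "L (a, b, c) = a *\<^sub>R L (1, 0, 0) + b *\<^sub>R L (0, 1, 0) + c *\<^sub>R L (0, 0, 1)"
  using linear_euclidean_sum[OF assms, of "(a, b, c)"]
  by (simp add: Basis_prod_def zero_prod_def add.assoc)

lemma has_derivative_curve: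
  assumes "(f has_derivative L) (at (y s))" "(y has_vector_derivative v) (at s)"
  shows "((\<lambda>s. f (y s)) has_vector_derivative L v) (at s)"
proof -
  have "((\<lambda>s. f (y s)) has_derivative (\<lambda>h. L (h *\<^sub>R v))) (at s)"
    using has_derivative_compose[OF assms(2)[unfolded has_vector_derivative_def] assms(1)] .
  then show ?thesis
    by (simp add: has_vector_derivative_def linear_cmul[OF has_derivative_linear[OF assms(1)]])
qed

lemma has_vector_derivative_Pair:
  assumes "(f has_vector_derivative u) (at s)" "(g has_vector_derivative v) (at s)"
  shows "((\<lambda>s. (f s, g s)) has_vector_derivative (u, v)) (at s)"
  using has_derivative_Pair[OF assms[unfolded has_vector_derivative_def]]
  by (simp add: has_vector_derivative_def)

lemma Dt_Dx_has_derivative: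
  assumes "smooth_on W f" "(t, x) \<in> W"
  shows "((\<lambda>s. f (s, x)) has_real_derivative Dt f (t, x)) (at t)"
    and "((\<lambda>y. f (t, y)) has_real_derivative Dx f (t, x)) (at x)"
    and "Dt f (t, x) = dir (1, 0) f (t, x)" and "Dx f (t, x) = dir (0, 1) f (t, x)"
proof -
  note f = smooth_on_has_derivative[OF assms]
  have "((\<lambda>s. (s, x)) has_vector_derivative (1, 0)) (at t)" "((\<lambda>y. (t, y)) has_vector_derivative (0, 1)) (at x)"
    by (auto intro!: has_vector_derivative_Pair derivative_eq_intros)
  from has_derivative_curve[of f _ "\<lambda>s. (s, x)", OF f this(1)] has_derivative_curve[of f _ "\<lambda>y. (t, y)", OF f this(2)]
  have *: "((\<lambda>s. f (s, x)) has_real_derivative dir (1, 0) f (t, x)) (at t)"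
    "((\<lambda>y. f (t, y)) has_real_derivative dir (0, 1) f (t, x)) (at x)"
    by (simp_all add: has_real_derivative_iff_has_vector_derivative)
  then show d: "Dt f (t, x) = dir (1, 0) f (t, x)" "Dx f (t, x) = dir (0, 1) f (t, x)"
    by (auto simp: Dt_def Dx_def dest: DERIV_imp_deriv)
  from * show "((\<lambda>s. f (s, x)) has_real_derivative Dt f (t, x)) (at t)"
    "((\<lambda>y. f (t, y)) has_real_derivative Dx f (t, x)) (at x)"
    unfolding d .
qed

lemma Dt_eqI: "((\<lambda>s. f (s, x)) has_real_derivative d) (at t) \<Longrightarrow> Dt f (t, x) = d"
  by (simp add: Dt_def DERIV_imp_deriv)

lemma Dx_eqI: "((\<lambda>y. f (t, y)) has_real_derivative d) (at x) \<Longrightarrow> Dx f (t, x) = d"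
  by (simp add: Dx_def DERIV_imp_deriv)

lemma smooth_on_Dx: "open W \<Longrightarrow> smooth_on W f \<Longrightarrow> smooth_on W (Dx f)"
  by (rule smooth_on_cong[OF _ _ smooth_on_dir[of W f "(0, 1)"]]) (auto simp: Dt_Dx_has_derivative(4))

lemma Dt_Dx_cong:
  assumes "open W" "p \<in> W" "\<And>q. q \<in> W \<Longrightarrow> f q = g q"
  shows "Dt f p = Dt g p" and "Dx f p = Dx g p"
proof -
  obtain t x where p: "p = (t, x)" by (cases p)
  have "\<forall>\<^sub>F s in nhds t. (s, x) \<in> W"
  proof -
    have "open ((\<lambda>s. (s, x)) -` W)" by (intro open_vimage assms continuous_intros)
    from eventually_nhds_in_open[OF this, of t] show ?thesis using assms(2) p by simp
  qed
  then show "Dt f p = Dt g p"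
    unfolding p Dt_def by (auto intro!: deriv_cong_ev elim!: eventually_mono simp: assms(3))
  have "\<forall>\<^sub>F s in nhds x. (t, s) \<in> W"
  proof -
    have "open ((\<lambda>s. (t, s)) -` W)" by (intro open_vimage assms continuous_intros)
    from eventually_nhds_in_open[OF this, of x] show ?thesis using assms(2) p by simp
  qed
  then show "Dx f p = Dx g p"
    unfolding p Dx_def by (auto intro!: deriv_cong_ev elim!: eventually_mono simp: assms(3))
qed

lemma DERIV_pair_chain:
  assumes "smooth_on M g" "(a s, b s) \<in> M"
    and "(a has_real_derivative a') (at s)" "(b has_real_derivative b') (at s)"
  shows "((\<lambda>s. g (a s, b s)) has_real_derivative a' * Dt g (a s, b s) + b' * Dx g (a s, b s)) (at s)"
proof -
  note g = smooth_on_has_derivative[OF assms(1,2)]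
  have "((\<lambda>s. g (a s, b s)) has_vector_derivative frechet_derivative g (at (a s, b s)) (a', b')) (at s)"
    using has_derivative_curve[of g _ "\<lambda>s. (a s, b s)", OF g] assms(3,4)
    by (auto simp: has_real_derivative_iff_has_vector_derivative intro: has_vector_derivative_Pair)
  then show ?thesis
    by (simp add: has_real_derivative_iff_has_vector_derivative linear_pair[OF has_derivative_linear[OF g], of a' b']
        Dt_Dx_has_derivative(3,4)[OF assms(1,2)])
qed

section \<open>Transformations affine in the dependent variable\<close>

text \<open>The defect of the equation, so that a change of variables becomes an identity for all
  functions and not only for solutions.\<close>

definition FP_residual :: "real \<Rightarrow> (real \<times> real \<Rightarrow> real) \<Rightarrow> (real \<times> real \<Rightarrow> real) \<Rightarrow> real \<times> real \<Rightarrow> real" where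
  "FP_residual \<epsilon> B f p = Dt f p - \<epsilon> * Dx (Dx f) p - B p * Dx f p - Dx B p * f p"

lemma jet2_in_FP_equation: "jet2 f p \<in> FP_equation \<epsilon> (D, B) \<longleftrightarrow> p \<in> D \<and> FP_residual \<epsilon> B f p = 0"
  by (cases p) (auto simp: FP_equation_def FP_residual_def)

lemma FP_solution_iff_residual:
  assumes "smooth_on D B" "W \<subseteq> D" "smooth_on W f"
  shows "FP_solution \<epsilon> B W f \<longleftrightarrow> (\<forall>p\<in>W. FP_residual \<epsilon> B f p = 0)"
proof -
  have "Dx (\<lambda>q. B q * f q) p = B p * Dx f p + Dx B p * f p" if "p \<in> W" for p
  proof (cases p)
    case (Pair t x)
    show ?thesis
      unfolding Pair using that assms(2) Pair
      by (auto intro!: Dx_eqI derivative_eq_intros Dt_Dx_has_derivative(2)[OF assms(1)] Dt_Dx_has_derivative(2)[OF assms(3)])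
  qed
  then show ?thesis
    using assms(3) by (auto simp: FP_solution_def FP_residual_def algebra_simps)
qed

text \<open>A candidate transformation: the drifts are not yet related and no solution condition is
  imposed. The functions \<open>coeff_ux\<close> and \<open>coeff\<close> below measure its failure
  to be admissible.\<close>

locale fiber_affine =
  fixes W :: "(real \<times> real) set" and T X1 X0 :: "real \<Rightarrow> real" and U1 U0 :: "real \<times> real \<Rightarrow> real"
    and \<epsilon> :: real and D D' :: "(real \<times> real) set" and B B' :: "real \<times> real \<Rightarrow> real"
  assumes W: "open W"
    and T: "smooth_on (fst ` W) T" and X1: "smooth_on (fst ` W) X1" and X0: "smooth_on (fst ` W) X0"
    and U1: "smooth_on W U1" and U0: "smooth_on W U0"
    and X1_nz: "\<And>t. t \<in> fst ` W \<Longrightarrow> X1 t \<noteq> 0" and T_X1: "\<And>t. t \<in> fst ` W \<Longrightarrow> deriv T t = (X1 t)\<^sup>2"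
    and U1_nz: "\<And>p. p \<in> W \<Longrightarrow> U1 p \<noteq> 0"
    and B: "open D" "smooth_on D B" "W \<subseteq> D" and B': "open D'" "smooth_on D' B'"
    and WD': "\<And>t x. (t, x) \<in> W \<Longrightarrow> (T t, X1 t * x + X0 t) \<in> D'"
begin

definition \<phi> :: "real \<times> real \<Rightarrow> real \<times> real" where
  "\<phi> p = (T (fst p), X1 (fst p) * snd p + X0 (fst p))"

text \<open>Differentiating g o \<open>\<phi>\<close> in t also moves the target x. Expressed
  through the x-derivative of g o \<open>\<phi>\<close>, this motion has coefficient
  \<open>drag\<close>.\<close>

definition drag :: "real \<times> real \<Rightarrow> real" where
  "drag p = (deriv X1 (fst p) * snd p + deriv X0 (fst p)) / X1 (fst p)"

definition coeff_ux :: "real \<times> real \<Rightarrow> real" where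
  "coeff_ux p = U1 p * B p - U1 p * drag p - 2 * \<epsilon> * Dx U1 p - X1 (fst p) * B' (\<phi> p) * U1 p"

text \<open>The target operator in source coordinates, multiplied by \<open>(X1)\<^sup>2\<close> and
  applied to \<open>U\<close>. Applied to \<open>U1\<close> f + \<open>U0\<close> and sorted by
  derivatives of f, it produces the remainder in \<open>transformed_residual\<close>; trading f_t
  for the source residual adds \<open>U1 p * Dx B p\<close>.\<close>

definition coeff :: "(real \<times> real \<Rightarrow> real) \<Rightarrow> real \<times> real \<Rightarrow> real" where
  "coeff U p = Dt U p - Dx U p * drag p - \<epsilon> * Dx (Dx U) p - X1 (fst p) * B' (\<phi> p) * Dx U p
     - (X1 (fst p))\<^sup>2 * Dx B' (\<phi> p) * U p"

lemma DERIV_smooth: "smooth_on (fst ` W) f \<Longrightarrow> (t, x) \<in> W \<Longrightarrow> (f has_real_derivative deriv f t) (at t)"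
  for f :: "real \<Rightarrow> real"
proof -
  assume "smooth_on (fst ` W) f" "(t, x) \<in> W"
  then have "(f has_derivative frechet_derivative f (at t)) (at t)"
    by (intro smooth_on_has_derivative) force+
  then have "f field_differentiable (at t)"
    using field_differentiable_def has_derivative_imp_has_field_derivative has_field_derivative_def
    by (metis differentiableI real_differentiable_def)
  then show ?thesis by (simp add: field_differentiable_derivI)
qed

text \<open>The chain rule for g o \<open>\<phi>\<close> = \<open>U1\<close> f + \<open>U0\<close>,
  once in t and twice in x. As T_t = \<open>(X1)\<^sup>2\<close>, one factor serves both the time
  derivative and the second space derivative of g, so f_t and f_xx recombine into the source
  residual.\<close>

lemma transformed_residual:
  assumes "open N" "N \<subseteq> W" "p \<in> N" "smooth_on N f" "smooth_on M g"
    and gf: "\<And>s. s \<in> N \<Longrightarrow> \<phi> s \<in> M \<and> g (\<phi> s) = U1 s * f s + U0 s"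
    and "open M"
  shows "(X1 (fst p))\<^sup>2 * FP_residual \<epsilon> B' g (\<phi> p) =
    U1 p * FP_residual \<epsilon> B f p + coeff_ux p * Dx f p + (coeff U1 p + U1 p * Dx B p) * f p + coeff U0 p"
proof -
  note dU1 = smooth_on_subset[OF U1 assms(2)] and dU0 = smooth_on_subset[OF U0 assms(2)]
  note ders = Dt_Dx_has_derivative(2)[OF dU1] Dt_Dx_has_derivative(2)[OF dU0] Dt_Dx_has_derivative(2)[OF assms(4)]
    Dt_Dx_has_derivative(1)[OF dU1] Dt_Dx_has_derivative(1)[OF dU0] Dt_Dx_has_derivative(1)[OF assms(4)]
    Dt_Dx_has_derivative(2)[OF smooth_on_Dx[OF assms(1) dU1]] Dt_Dx_has_derivative(2)[OF smooth_on_Dx[OF assms(1) dU0]]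
    Dt_Dx_has_derivative(2)[OF smooth_on_Dx[OF assms(1,4)]]
  note cong = Dt_Dx_cong[OF assms(1)]
  have gx: "X1 (fst s) * Dx g (\<phi> s) = Dx U1 s * f s + U1 s * Dx f s + Dx U0 s" if s: "s \<in> N" for s
  proof -
    obtain t x where tx: "s = (t, x)" by (cases s)
    have "((\<lambda>y. g (\<phi> (t, y))) has_real_derivative 0 * Dt g (\<phi> (t, x)) + X1 t * Dx g (\<phi> (t, x))) (at x)"
      using gf[OF s] unfolding \<phi>_def tx fst_conv snd_conv
      by (intro DERIV_pair_chain[OF assms(5)]) (auto intro!: derivative_eq_intros)
    from Dx_eqI[of "\<lambda>s. g (\<phi> s)", OF this]
    have "X1 t * Dx g (\<phi> (t, x)) = Dx (\<lambda>s. U1 s * f s + U0 s) (t, x)"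
      using cong(2)[OF that, of "\<lambda>s. g (\<phi> s)" "\<lambda>s. U1 s * f s + U0 s"] gf tx by simp
    also have "\<dots> = Dx U1 (t, x) * f (t, x) + U1 (t, x) * Dx f (t, x) + Dx U0 (t, x)"
      using that tx by (auto intro!: Dx_eqI derivative_eq_intros ders)
    finally show ?thesis by (simp add: tx)
  qed
  obtain t x where tx: "p = (t, x)" by (cases p)
  have pW: "(t, x) \<in> W" "(t, x) \<in> N" "t \<in> fst ` W" using assms(2,3) tx by force+
  have "((\<lambda>y. X1 t * Dx g (\<phi> (t, y))) has_real_derivative
      X1 t * (0 * Dt (Dx g) (\<phi> (t, x)) + X1 t * Dx (Dx g) (\<phi> (t, x)))) (at x)"
    using gf[OF assms(3)] unfolding \<phi>_def tx fst_conv snd_conv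
    by (intro DERIV_cmult DERIV_pair_chain[OF smooth_on_Dx[OF assms(7,5)]]) (auto intro!: derivative_eq_intros)
  from Dx_eqI[of "\<lambda>s. X1 (fst s) * Dx g (\<phi> s)" t, unfolded fst_conv, OF this]
  have "(X1 t)\<^sup>2 * Dx (Dx g) (\<phi> p) = Dx (\<lambda>s. Dx U1 s * f s + U1 s * Dx f s + Dx U0 s) (t, x)"
    using cong(2)[OF assms(3), of "\<lambda>s. X1 (fst s) * Dx g (\<phi> s)" "\<lambda>s. Dx U1 s * f s + U1 s * Dx f s + Dx U0 s"] gx tx
    by (simp add: power2_eq_square)
  also have "\<dots> = Dx (Dx U1) p * f p + 2 * Dx U1 p * Dx f p + U1 p * Dx (Dx f) p + Dx (Dx U0) p"
    unfolding tx using pW by (auto intro!: Dx_eqI derivative_eq_intros ders)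
  finally have gxx: "(X1 t)\<^sup>2 * Dx (Dx g) (\<phi> p) = \<dots>" .
  have "((\<lambda>s. g (\<phi> (s, x))) has_real_derivative
      deriv T t * Dt g (\<phi> (t, x)) + (deriv X1 t * x + deriv X0 t) * Dx g (\<phi> (t, x))) (at t)"
    using gf[OF assms(3)] unfolding \<phi>_def tx fst_conv snd_conv
    by (intro DERIV_pair_chain[OF assms(5)]) (auto intro!: derivative_eq_intros DERIV_smooth[OF _ pW(1)] T X1 X0)
  from Dt_eqI[of "\<lambda>s. g (\<phi> s)", OF this]
  have "deriv T t * Dt g (\<phi> p) + (deriv X1 t * x + deriv X0 t) * Dx g (\<phi> p) = Dt (\<lambda>s. U1 s * f s + U0 s) (t, x)"
    using cong(1)[OF assms(3), of "\<lambda>s. g (\<phi> s)" "\<lambda>s. U1 s * f s + U0 s"] gf tx by simp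
  also have "\<dots> = Dt U1 p * f p + U1 p * Dt f p + Dt U0 p"
    unfolding tx using pW by (auto intro!: Dt_eqI derivative_eq_intros ders)
  finally have gt: "(X1 t)\<^sup>2 * Dt g (\<phi> p) + X1 t * drag p * Dx g (\<phi> p) = Dt U1 p * f p + U1 p * Dt f p + Dt U0 p"
    using T_X1[OF pW(3)] X1_nz[OF pW(3)] by (simp add: drag_def tx)
  have g0: "g (\<phi> p) = U1 p * f p + U0 p" using gf assms(3) by blast
  show ?thesis
    unfolding FP_residual_def coeff_def coeff_ux_def using gx[OF assms(3)] gxx gt g0 by (simp add: tx, algebra)
qed

text \<open>\<open>coeff_ux\<close> is X1 U1 times the right side minus the left side, and X1 U1
  vanishes nowhere.\<close>

lemma drift_relation_iff:
  assumes "p \<in> W"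
  shows "coeff_ux p = 0 \<longleftrightarrow> B' (\<phi> p) = 1 / X1 (fst p) * (B p - 2 * \<epsilon> * (Dx U1 p / U1 p))
    - (deriv X1 (fst p) * snd p + deriv X0 (fst p)) / (X1 (fst p))\<^sup>2"
proof -
  have nz: "X1 (fst p) \<noteq> 0" "U1 p \<noteq> 0" using X1_nz[OF imageI[OF assms]] U1_nz[OF assms] by auto
  have "coeff_ux p = X1 (fst p) * U1 p * (1 / X1 (fst p) * (B p - 2 * \<epsilon> * (Dx U1 p / U1 p))
    - (deriv X1 (fst p) * snd p + deriv X0 (fst p)) / (X1 (fst p))\<^sup>2 - B' (\<phi> p))"
    unfolding coeff_ux_def drag_def using nz by (simp add: field_simps power2_eq_square)
  then show ?thesis using nz by auto
qed

section \<open>Consequences of the drift relation\<close>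

context
  assumes coeff_ux_0: "\<And>p. p \<in> W \<Longrightarrow> coeff_ux p = 0"
begin

text \<open>The x-derivative of the drift relation; its last term is the x-derivative of
  \<open>drag\<close>. Together with the relation itself it removes the target drift from
  \<open>coeff\<close>.\<close>

lemma Dx_transformed_drift:
  assumes "p \<in> W"
  shows "(X1 (fst p))\<^sup>2 * Dx B' (\<phi> p) =
    Dx B p - 2 * \<epsilon> * ((Dx (Dx U1) p * U1 p - (Dx U1 p)\<^sup>2) / (U1 p)\<^sup>2) - deriv X1 (fst p) / X1 (fst p)"
proof -
  obtain t x where tx: "p = (t, x)" by (cases p)
  have nz: "X1 t \<noteq> 0" "U1 (t, x) \<noteq> 0" using X1_nz U1_nz assms tx by force+
  note pW = assms[unfolded tx]
  have eq: "X1 (fst s) * B' (\<phi> s) = B s - 2 * \<epsilon> * (Dx U1 s / U1 s) - drag s" if "s \<in> W" for s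
    using coeff_ux_0[OF that] U1_nz[OF that] by (simp add: coeff_ux_def field_simps)
  have "((\<lambda>y. X1 t * B' (\<phi> (t, y))) has_real_derivative X1 t * (0 * Dt B' (\<phi> (t, x)) + X1 t * Dx B' (\<phi> (t, x)))) (at x)"
    using WD'[OF pW] unfolding \<phi>_def fst_conv snd_conv
    by (intro DERIV_cmult DERIV_pair_chain[OF B'(2)]) (auto intro!: derivative_eq_intros)
  from Dx_eqI[of "\<lambda>s. X1 (fst s) * B' (\<phi> s)" t, unfolded fst_conv, OF this]
  have "(X1 t)\<^sup>2 * Dx B' (\<phi> p) = Dx (\<lambda>s. B s - 2 * \<epsilon> * (Dx U1 s / U1 s) - drag s) (t, x)"
    using Dt_Dx_cong(2)[OF W assms, of "\<lambda>s. X1 (fst s) * B' (\<phi> s)" "\<lambda>s. B s - 2 * \<epsilon> * (Dx U1 s / U1 s) - drag s"] eq tx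
    by (simp add: power2_eq_square)
  also have "\<dots> = Dx B p - 2 * \<epsilon> * ((Dx (Dx U1) p * U1 p - (Dx U1 p)\<^sup>2) / (U1 p)\<^sup>2) - deriv X1 t / X1 t"
    unfolding tx drag_def fst_conv snd_conv
    by (rule Dx_eqI)
      (use nz B(3) pW in \<open>auto intro!: derivative_eq_intros Dt_Dx_has_derivative(2)[OF B(2)]
        Dt_Dx_has_derivative(2)[OF U1] Dt_Dx_has_derivative(2)[OF smooth_on_Dx[OF W U1]]
        simp: power2_eq_square right_diff_distrib mult.assoc mult.left_commute\<close>)
  finally show ?thesis by (simp add: tx)
qed

text \<open>Once the target drift is eliminated, the terms with \<open>Dx B\<close> cancel, and the
  derivative of U1_x / U1 in the drift relation reverses the sign of \<epsilon> U1_xx, as in the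
  adjoint equation. The term \<open>deriv X1 t / X1 t\<close>, inherited from \<open>drag\<close>,
  is what makes X1 U1 rather than U1 the solution.\<close>

lemma adjoint_iff:
  "adjoint_solution \<epsilon> B W (\<lambda>(t, x). X1 t * U1 (t, x)) \<longleftrightarrow> (\<forall>p\<in>W. coeff U1 p + U1 p * Dx B p = 0)"
proof -
  let ?f = "\<lambda>(t, x). X1 t * U1 (t, x)"
  have sm: "smooth_on W ?f"
    unfolding case_prod_unfold prod.collapse
    by (intro smooth_on_mult W U1 smooth_on_compose[OF W X1] smooth_on_fst smooth_on_ident subset_refl)
  have f_x: "Dx ?f p = X1 (fst p) * Dx U1 p" if "p \<in> W" for p
    using that by (cases p) (auto intro!: Dx_eqI derivative_eq_intros Dt_Dx_has_derivative(2)[OF U1])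
  have pt: "Dt ?f p = - \<epsilon> * Dx (Dx ?f) p + B p * Dx ?f p \<longleftrightarrow> coeff U1 p + U1 p * Dx B p = 0" if p: "p \<in> W" for p
  proof -
    obtain t x where tx: "p = (t, x)" by (cases p)
    note pW = p[unfolded tx]
    have nz: "X1 t \<noteq> 0" "U1 p \<noteq> 0" using X1_nz U1_nz p tx by force+
    have f_t: "Dt ?f p = deriv X1 t * U1 p + X1 t * Dt U1 p"
      unfolding tx by (rule Dt_eqI) (auto intro!: derivative_eq_intros DERIV_smooth[OF X1 pW] Dt_Dx_has_derivative(1)[OF U1 pW])
    have "Dx (Dx ?f) p = Dx (\<lambda>p. X1 (fst p) * Dx U1 p) (t, x)"
      using Dt_Dx_cong(2)[OF W p, of "Dx ?f" "\<lambda>p. X1 (fst p) * Dx U1 p"] f_x tx by simp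
    also have "\<dots> = X1 t * Dx (Dx U1) p"
      unfolding tx by (rule Dx_eqI) (auto intro!: derivative_eq_intros Dt_Dx_has_derivative(2)[OF smooth_on_Dx[OF W U1] pW])
    finally have f_xx: "Dx (Dx ?f) p = X1 t * Dx (Dx U1) p" .
    \<comment> \<open>These quotients turn all relations into polynomial ones, as
      \<open>algebra\<close> requires.\<close>
    define r q k where "r = Dx U1 p / U1 p" and "q = Dx (Dx U1) p / U1 p" and "k = deriv X1 t / X1 t"
    then have rqk: "Dx U1 p = r * U1 p" "Dx (Dx U1) p = q * U1 p" "deriv X1 t = k * X1 t"
      using nz by simp_all
    have A: "X1 t * B' (\<phi> p) = B p - 2 * \<epsilon> * r - drag p"
      using coeff_ux_0[OF p] nz by (simp add: coeff_ux_def field_simps tx r_def)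
    have D: "(X1 t)\<^sup>2 * Dx B' (\<phi> p) = Dx B p - 2 * \<epsilon> * (q - r\<^sup>2) - k"
      using Dx_transformed_drift[OF p] nz by (simp add: q_def r_def k_def tx field_simps power2_eq_square)
    have "X1 t * (coeff U1 p + U1 p * Dx B p) = Dt ?f p - (- \<epsilon> * Dx (Dx ?f) p + B p * Dx ?f p)"
      unfolding coeff_def f_t f_xx f_x[OF p] using rqk A D unfolding tx fst_conv by algebra
    then show ?thesis using nz by auto
  qed
  show ?thesis unfolding adjoint_solution_def using sm pt by blast
qed

text \<open>Write U0 = U1 V. As in \<open>transformed_residual\<close> with f = V,
  \<open>coeff U0\<close> is U1 times the residual of V plus multiples of two coefficients that
  vanish here. Up to sign, V is the preimage of the zero solution of the target equation.\<close>

lemma FP_quotient_iff: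
  assumes "\<And>p. p \<in> W \<Longrightarrow> coeff U1 p + U1 p * Dx B p = 0"
  shows "FP_solution \<epsilon> B W (\<lambda>p. U0 p / U1 p) \<longleftrightarrow> (\<forall>p\<in>W. coeff U0 p = 0)"
proof -
  let ?V = "\<lambda>p. U0 p / U1 p"
  have sm: "smooth_on W ?V" by (intro smooth_on_divide W U0 U1 U1_nz)
  note ders = Dt_Dx_has_derivative(2)[OF U1] Dt_Dx_has_derivative(2)[OF sm]
    Dt_Dx_has_derivative(1)[OF U1] Dt_Dx_has_derivative(1)[OF sm]
    Dt_Dx_has_derivative(2)[OF smooth_on_Dx[OF W U1]] Dt_Dx_has_derivative(2)[OF smooth_on_Dx[OF W sm]]
  have U: "U0 p = U1 p * ?V p" if "p \<in> W" for p using U1_nz[OF that] by simp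
  have x: "Dx U0 p = Dx U1 p * ?V p + U1 p * Dx ?V p" if "p \<in> W" for p
  proof -
    obtain t x where tx: "p = (t, x)" by (cases p)
    have "Dx U0 p = Dx (\<lambda>p. U1 p * ?V p) p" by (rule Dt_Dx_cong[OF W that U])
    also have "\<dots> = Dx U1 p * ?V p + U1 p * Dx ?V p"
      unfolding tx by (rule Dx_eqI, rule DERIV_cong, rule DERIV_mult)
        (use that tx in \<open>auto intro!: ders\<close>)
    finally show ?thesis .
  qed
  have "coeff U0 p = U1 p * FP_residual \<epsilon> B ?V p" if p: "p \<in> W" for p
  proof -
    obtain t x where tx: "p = (t, x)" by (cases p)
    have "Dx (Dx U0) p = Dx (\<lambda>p. Dx U1 p * ?V p + U1 p * Dx ?V p) p" by (rule Dt_Dx_cong[OF W p x])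
    also have "\<dots> = (Dx (Dx U1) p * ?V p + Dx ?V p * Dx U1 p) + (Dx U1 p * Dx ?V p + Dx (Dx ?V) p * U1 p)"
      unfolding tx by (intro Dx_eqI DERIV_add DERIV_mult ders p[unfolded tx])
    finally have xx: "Dx (Dx U0) p = \<dots>" .
    have "Dt U0 p = Dt (\<lambda>p. U1 p * ?V p) p" by (rule Dt_Dx_cong[OF W p U])
    also have "\<dots> = Dt U1 p * ?V p + U1 p * Dt ?V p"
      unfolding tx by (rule Dt_eqI, rule DERIV_cong, rule DERIV_mult)
        (use p tx in \<open>auto intro!: ders\<close>)
    finally have t: "Dt U0 p = \<dots>" .
    show ?thesis
      using coeff_ux_0[OF p] assms[OF p] U[OF p] x[OF p] xx t
      unfolding coeff_ux_def coeff_def FP_residual_def by algebra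
  qed
  then show ?thesis
    using FP_solution_iff_residual[OF B(2,3) sm] U1_nz by auto
qed

end

end

section \<open>Sufficiency of the normal form\<close>

lemma smooth_on_base: "open S \<Longrightarrow> smooth_on S base"
  by (rule smooth_on_cong[of S "\<lambda>z. (fst z, fst (snd z))"]) (auto intro!: smooth_intros)

lemma open_base_image:
  assumes "open \<Omega>"
  shows "open (base ` \<Omega>)"
proof -
  have "base ` \<Omega> = (\<Union>u. (\<lambda>p. (fst p, snd p, u)) -` \<Omega>)"
    by (force simp: image_iff)
  moreover have "open ((\<lambda>p. (fst p, snd p, u)) -` \<Omega>)" for u
    by (intro open_vimage assms continuous_intros)
  ultimately show ?thesis by auto
qed

lemma fst_base_image: "fst ` base ` \<Omega> = fst ` \<Omega>"
  by (force simp: image_iff)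

lemma base_graph_pt [simp]: "base (graph_pt f p) = p"
  by (cases p) simp

lemma smooth_local_inverse:
  fixes F :: "real \<times> real \<Rightarrow> real \<times> real"
  assumes S: "open S" "p \<in> S" and F: "smooth_on S F"
    and det: "Dt (\<lambda>q. fst (F q)) p * Dx (\<lambda>q. snd (F q)) p - Dx (\<lambda>q. fst (F q)) p * Dt (\<lambda>q. snd (F q)) p \<noteq> 0"
  obtains N M h where "open N" "p \<in> N" "N \<subseteq> S" "open M" "F ` N = M" "smooth_on M h"
    "\<And>s. s \<in> N \<Longrightarrow> h (F s) = s" "h ` M = N" "\<And>r. r \<in> M \<Longrightarrow> F (h r) = r"
proof -
  have "frechet_derivative (\<lambda>q. fst (F q)) (at p) v = fst (frechet_derivative F (at p) v)"
    "frechet_derivative (\<lambda>q. snd (F q)) (at p) v = snd (frechet_derivative F (at p) v)" for v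
    using frechet_derivative_at[OF has_derivative_fst[OF smooth_on_has_derivative[OF F S(2)]]]
      frechet_derivative_at[OF has_derivative_snd[OF smooth_on_has_derivative[OF F S(2)]]] by metis+
  then have "Dt (\<lambda>q. fst (F q)) p = fst (dir (1, 0) F p)" "Dx (\<lambda>q. fst (F q)) p = fst (dir (0, 1) F p)"
    "Dt (\<lambda>q. snd (F q)) p = snd (dir (1, 0) F p)" "Dx (\<lambda>q. snd (F q)) p = snd (dir (0, 1) F p)"
    using Dt_Dx_has_derivative(3,4)[OF smooth_on_fst[OF S(1) F], of "fst p" "snd p"]
      Dt_Dx_has_derivative(3,4)[OF smooth_on_snd[OF S(1) F], of "fst p" "snd p"] S(2) by simp_all
  then show ?thesis
    using smooth_inverse_function_2[OF S F] det that by metis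
qed

locale fiber_affine_map = fiber_affine +
  fixes \<Omega> :: "(real \<times> real \<times> real) set" and \<Phi> :: "real \<times> real \<times> real \<Rightarrow> real \<times> real \<times> real"
  assumes \<Omega>: "open \<Omega>" and W_eq: "W = base ` \<Omega>"
    and \<Phi>: "\<And>t x u. (t, x, u) \<in> \<Omega> \<Longrightarrow> \<Phi> (t, x, u) = (T t, X1 t * x + X0 t, U1 (t, x) * u + U0 (t, x))"
begin

text \<open>Inversion in two stages: the base map has a triangular Jacobian matrix with determinant
  \<open>X1 t ^ 3\<close>, and once the base point is recovered, u is found by solving an affine
  equation with slope U1.\<close>

lemma is_point_transformation: "is_point_transformation (\<Omega>, \<Phi>)"
proof -
  have sm_\<phi>: "smooth_on W \<phi>"
    unfolding \<phi>_def by (intro smooth_intros W subset_refl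
      smooth_on_compose[OF W T] smooth_on_compose[OF W X1] smooth_on_compose[OF W X0])
  have "\<exists>V \<Psi>. open V \<and> z \<in> V \<and> V \<subseteq> \<Omega> \<and> open (\<Phi> ` V) \<and> smooth_on V \<Phi> \<and> smooth_on (\<Phi> ` V) \<Psi> \<and> (\<forall>w\<in>V. \<Psi> (\<Phi> w) = w)"
    if z: "z \<in> \<Omega>" for z
  proof -
    obtain t x u where tx: "z = (t, x, u)" by (cases z)
    have p: "(t, x) \<in> W" "t \<in> fst ` W" using z tx W_eq by force+
    have "Dt (\<lambda>q. fst (\<phi> q)) (t, x) = (X1 t)\<^sup>2" "Dx (\<lambda>q. fst (\<phi> q)) (t, x) = 0" "Dx (\<lambda>q. snd (\<phi> q)) (t, x) = X1 t"
      using DERIV_smooth[OF T p(1)] T_X1[OF p(2)] unfolding \<phi>_def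
      by (auto intro!: Dt_eqI Dx_eqI derivative_eq_intros)
    then obtain N M h where N: "open N" "(t, x) \<in> N" "N \<subseteq> W" "open M" "\<phi> ` N = M" "smooth_on M h"
      and h: "\<And>s. s \<in> N \<Longrightarrow> h (\<phi> s) = s" "h ` M = N" "\<And>r. r \<in> M \<Longrightarrow> \<phi> (h r) = r"
      using smooth_local_inverse[OF W p(1) sm_\<phi>] X1_nz[OF p(2)] by auto
    define V where "V = base -` N \<inter> \<Omega>"
    have cb: "continuous_on UNIV base"
      by (rule smooth_on_continuous[OF smooth_on_base]) simp
    have V: "open V" "z \<in> V" "V \<subseteq> \<Omega>" "base ` V \<subseteq> W"
      unfolding V_def using open_vimage[OF N(1) cb] \<Omega> z tx N by auto
    define M' where "M' = base -` M"
    have M': "open M'" unfolding M'_def by (rule open_vimage[OF N(4) cb])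
    define \<Psi> where "\<Psi> w = (fst (h (base w)), snd (h (base w)),
      (snd (snd w) - U0 (h (base w))) / U1 (h (base w)))" for w :: "real \<times> real \<times> real"
    have hW: "h (base w) \<in> N" if "w \<in> M'" for w using h(2) that by (auto simp: M'_def)
    have sm_h: "smooth_on M' (\<lambda>w. h (base w))"
      by (rule smooth_on_compose[OF M' N(6)]) (auto simp: M'_def intro: smooth_on_base M'[unfolded M'_def])
    have sm_\<Psi>: "smooth_on M' \<Psi>"
      unfolding \<Psi>_def using hW N(3)
      by (intro smooth_intros M' sm_h smooth_on_compose[OF M' U0 _ sm_h] smooth_on_compose[OF M' U1 _ sm_h] U1_nz) auto
    have \<Phi>V: "\<Phi> w \<in> M'" "\<Psi> (\<Phi> w) = w" if w: "w \<in> V" for w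
    proof -
      obtain s y v where w': "w = (s, y, v)" by (cases w)
      have sy: "(s, y) \<in> N" "(s, y, v) \<in> \<Omega>" using w by (auto simp: V_def w')
      have b: "base (\<Phi> w) = \<phi> (s, y)" using \<Phi>[OF sy(2)] by (simp add: w' \<phi>_def)
      show "\<Phi> w \<in> M'" using b N(5) sy by (auto simp: M'_def)
      have "U1 (s, y) \<noteq> 0" using U1_nz sy N(3) by auto
      then show "\<Psi> (\<Phi> w) = w"
        unfolding \<Psi>_def b h(1)[OF sy(1)] using \<Phi>[OF sy(2)] by (simp add: w')
    qed
    \<comment> \<open>As a preimage under the continuous explicit inverse, the image of
      \<open>V\<close> is open.\<close>
    have im: "\<Phi> ` V = \<Psi> -` V \<inter> M'"
    proof (intro equalityI subsetI)
      fix w assume "w \<in> \<Phi> ` V"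
      then show "w \<in> \<Psi> -` V \<inter> M'" using \<Phi>V by auto
    next
      fix w assume w: "w \<in> \<Psi> -` V \<inter> M'"
      obtain a b c where w': "w = (a, b, c)" by (cases w)
      obtain s y where sy: "h (a, b) = (s, y)" by (cases "h (a, b)")
      have "(s, y) \<in> N" "\<phi> (s, y) = (a, b)" using hW[of w] w h(3)[of "(a, b)"] sy by (auto simp: w' M'_def)
      moreover have "U1 (s, y) \<noteq> 0" using U1_nz \<open>(s, y) \<in> N\<close> N(3) by auto
      moreover have "\<Psi> w = (s, y, (c - U0 (s, y)) / U1 (s, y))" by (simp add: \<Psi>_def w' sy)
      moreover from this have "(s, y, (c - U0 (s, y)) / U1 (s, y)) \<in> \<Omega>" using w by (auto simp: V_def)
      ultimately have "\<Phi> (\<Psi> w) = w" using \<Phi> by (simp add: w' \<phi>_def)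
      then show "w \<in> \<Phi> ` V" using w by (metis IntD1 imageI vimageD)
    qed
    have "open (\<Phi> ` V)"
      unfolding im using continuous_open_preimage[OF smooth_on_continuous[OF sm_\<Psi>] M' V(1)] by (simp add: Int_commute)
    moreover have "smooth_on V \<Phi>"
    proof (rule smooth_on_cong[OF V(1)])
      have fst_W: "fst z \<in> fst ` W" if "z \<in> V" for z using V(3) W_eq that by (cases z) force
      show "smooth_on V (\<lambda>z. (T (fst z), X1 (fst z) * fst (snd z) + X0 (fst z), U1 (base z) * snd (snd z) + U0 (base z)))"
        using fst_W V(4)
        by (intro smooth_intros V(1) smooth_on_compose[OF V(1) T]
            smooth_on_compose[OF V(1) X1] smooth_on_compose[OF V(1) X0] smooth_on_compose[OF V(1) U1 _ smooth_on_base]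
            smooth_on_compose[OF V(1) U0 _ smooth_on_base]) auto
      show "(T (fst z), X1 (fst z) * fst (snd z) + X0 (fst z), U1 (base z) * snd (snd z) + U0 (base z)) = \<Phi> z" if "z \<in> V" for z
        using V(3) that \<Phi> by (cases z) auto
    qed
    moreover have "smooth_on (\<Phi> ` V) \<Psi>" using sm_\<Psi> im smooth_on_subset by blast
    ultimately show ?thesis using V \<Phi>V(2) by blast
  qed
  then show ?thesis unfolding is_point_transformation_def using \<Omega> by simp
qed

text \<open>The base components of \<open>\<Phi>\<close> ignore u. Hence the image jet can only sit
  over \<open>\<phi> p\<close>, and g o \<open>\<phi>\<close> is forced to be \<open>U1\<close> f +
  \<open>U0\<close>, so \<open>transformed_residual\<close> covers every pair in the
  prolongation.\<close>

lemma prolongation_residual: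
  assumes "(j, j') \<in> prolongation (\<Omega>, \<Phi>)"
  obtains f p g where "j = jet2 f p" "j' = jet2 g (\<phi> p)" "p \<in> W"
    "(X1 (fst p))\<^sup>2 * FP_residual \<epsilon> B' g (\<phi> p) =
      U1 p * FP_residual \<epsilon> B f p + coeff_ux p * Dx f p + (coeff U1 p + U1 p * Dx B p) * f p + coeff U0 p"
proof -
  have "\<exists>f p g q N M. j = jet2 f p \<and> j' = jet2 g q \<and> open N \<and> p \<in> N \<and> smooth_on N f \<and> open M \<and> smooth_on M g \<and>
    (\<forall>s\<in>N. graph_pt f s \<in> \<Omega> \<and> (\<exists>r\<in>M. \<Phi> (graph_pt f s) = graph_pt g r)) \<and>
    q \<in> M \<and> \<Phi> (graph_pt f p) = graph_pt g q"
    using assms unfolding prolongation_def prod.case mem_Collect_eq prod.inject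
    by (elim exE conjE) (intro exI conjI, assumption+)
  then obtain f p g q N M where j: "j = jet2 f p" "j' = jet2 g q" and N: "open N" "p \<in> N" "smooth_on N f"
    and M: "open M" "smooth_on M g"
    and fg: "\<And>s. s \<in> N \<Longrightarrow> graph_pt f s \<in> \<Omega> \<and> (\<exists>r\<in>M. \<Phi> (graph_pt f s) = graph_pt g r)"
    and q: "q \<in> M" "\<Phi> (graph_pt f p) = graph_pt g q"
    by metis
  have NW: "N \<subseteq> W"
  proof
    fix s assume "s \<in> N"
    then have "base (graph_pt f s) \<in> base ` \<Omega>" using fg by blast
    then show "s \<in> W" by (simp only: base_graph_pt W_eq)
  qed
  have \<Phi>g: "\<Phi> (graph_pt f s) = (fst (\<phi> s), snd (\<phi> s), U1 s * f s + U0 s)" if "s \<in> N" for s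
    using \<Phi> fg[OF that] by (cases s) (simp add: \<phi>_def)
  have r: "r = \<phi> s \<and> g (\<phi> s) = U1 s * f s + U0 s" if "s \<in> N" "\<Phi> (graph_pt f s) = graph_pt g r" for s r
    using \<Phi>g[OF that(1)] that(2) by (cases r) auto
  have "q = \<phi> p" using r[OF N(2) q(2)] by simp
  moreover have "\<phi> s \<in> M \<and> g (\<phi> s) = U1 s * f s + U0 s" if "s \<in> N" for s
    using fg[OF that] r[OF that] by metis
  ultimately show ?thesis
    using that[of f p g] j N NW transformed_residual[OF N(1) NW N(2,3) M(2) _ M(1)] by blast
qed

text \<open>Without remainder the two residuals agree up to the nonzero factors
  \<open>(X1)\<^sup>2\<close> and \<open>U1\<close>, so they vanish together.\<close>

lemma maps_FP_equation:
  assumes "\<And>p. p \<in> W \<Longrightarrow> coeff_ux p = 0" "\<And>p. p \<in> W \<Longrightarrow> coeff U1 p + U1 p * Dx B p = 0"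
    "\<And>p. p \<in> W \<Longrightarrow> coeff U0 p = 0"
  shows "maps_equation (\<Omega>, \<Phi>) (FP_equation \<epsilon> (D, B)) (FP_equation \<epsilon> (D', B'))"
  unfolding maps_equation_def
proof (intro ballI, clarify)
  fix j j' assume "(j, j') \<in> prolongation (\<Omega>, \<Phi>)"
  then obtain f p g where j: "j = jet2 f p" "j' = jet2 g (\<phi> p)" "p \<in> W"
    and "(X1 (fst p))\<^sup>2 * FP_residual \<epsilon> B' g (\<phi> p) =
      U1 p * FP_residual \<epsilon> B f p + coeff_ux p * Dx f p + (coeff U1 p + U1 p * Dx B p) * f p + coeff U0 p"
    by (rule prolongation_residual)
  then have "FP_residual \<epsilon> B' g (\<phi> p) = 0 \<longleftrightarrow> FP_residual \<epsilon> B f p = 0"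
    using assms[OF j(3)] X1_nz[OF imageI[OF j(3)]] U1_nz[OF j(3)] by (metis add_0_right mult_eq_0_iff mult_zero_left zero_eq_power2)
  moreover have "\<phi> p \<in> D'" using WD'[of "fst p" "snd p"] j(3) by (simp add: \<phi>_def)
  ultimately show "j \<in> FP_equation \<epsilon> (D, B) \<longleftrightarrow> j' \<in> FP_equation \<epsilon> (D', B')"
    unfolding j jet2_in_FP_equation using j(3) B(3) by auto
qed

end

lemma admissible_form_imp_groupoid:
  assumes "is_drift (D, B)" and "is_drift (D', B')" and "open \<Omega>" and "base ` \<Omega> \<subseteq> D"
    and form: "admissible_form \<epsilon> B (\<Omega>, \<Phi>) (D', B') T X1 X0 U1 U0"
  shows "((D, B), (\<Omega>, \<Phi>), (D', B')) \<in> equivalence_groupoid \<epsilon>"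
proof -
  have sm: "smooth_on (fst ` base ` \<Omega>) T" "smooth_on (fst ` base ` \<Omega>) X1" "smooth_on (fst ` base ` \<Omega>) X0"
    "smooth_on (base ` \<Omega>) U1" "smooth_on (base ` \<Omega>) U0"
    and sol: "adjoint_solution \<epsilon> B (base ` \<Omega>) (\<lambda>(t, x). X1 t * U1 (t, x))"
      "FP_solution \<epsilon> B (base ` \<Omega>) (\<lambda>p. U0 p / U1 p)"
    using form unfolding admissible_form_def prod.case fst_base_image by blast+
  have \<Phi>: "\<Phi> (t, x, u) = (T t, X1 t * x + X0 t, U1 (t, x) * u + U0 (t, x))" if "(t, x, u) \<in> \<Omega>" for t x u
    using form that unfolding admissible_form_def by auto
  have X1: "X1 t \<noteq> 0" "deriv T t = (X1 t)\<^sup>2" if "t \<in> fst ` base ` \<Omega>" for t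
    using form that unfolding admissible_form_def fst_base_image by auto
  have U1: "U1 p \<noteq> 0" if "p \<in> base ` \<Omega>" for p
    using form that unfolding admissible_form_def by (cases p) fastforce
  have rel: "(T t, X1 t * x + X0 t) \<in> D'"
    "B' (T t, X1 t * x + X0 t) = 1 / X1 t * (B (t, x) - 2 * \<epsilon> * (Dx U1 (t, x) / U1 (t, x)))
      - (deriv X1 t * x + deriv X0 t) / (X1 t)\<^sup>2" if "(t, x) \<in> base ` \<Omega>" for t x
    using form that unfolding admissible_form_def by fastforce+
  interpret fiber_affine_map "base ` \<Omega>" T X1 X0 U1 U0 \<epsilon> D D' B B' \<Omega> \<Phi>
    using assms(1,2) by unfold_locales
      (simp_all only: not_False_eq_True is_drift_def prod.case sm \<Phi> X1 U1 rel assms(3,4) open_base_image)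
  have ux: "coeff_ux p = 0" if p: "p \<in> base ` \<Omega>" for p
    unfolding drift_relation_iff[OF p] using rel(2) p by (cases p) (simp add: \<phi>_def)
  have u: "coeff U1 p + U1 p * Dx B p = 0" if "p \<in> base ` \<Omega>" for p
    using adjoint_iff[OF ux] sol that by blast
  have u0: "coeff U0 p = 0" if "p \<in> base ` \<Omega>" for p
    using FP_quotient_iff[OF ux u] sol that by blast
  have "base (\<Phi> z) \<in> D'" if "z \<in> \<Omega>" for z
    using rel(1) \<Phi> imageI[OF that, of base] that by (cases z) simp
  then show ?thesis
    unfolding equivalence_groupoid_def
    using assms is_point_transformation maps_FP_equation[OF ux u u0] by auto
qed

section \<open>Images of jets under an admissible transformation\<close>

lemma dir_sum_Basis:
  fixes G :: "'b::euclidean_space \<Rightarrow> real"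
  assumes "smooth_on S G" "z \<in> S"
  shows "dir w G z = (\<Sum>b\<in>Basis. (w \<bullet> b) * dir b G z)"
  using linear_euclidean_sum[OF has_derivative_linear[OF smooth_on_has_derivative[OF assms]], of w] by simp

lemma dir_dir_sum_Basis:
  fixes G :: "'b::euclidean_space \<Rightarrow> real"
  assumes "open S" "smooth_on S G" "z \<in> S"
  shows "dir v (dir w G) z = (\<Sum>b\<in>Basis. (w \<bullet> b) * dir v (dir b G) z)"
proof -
  have "((\<lambda>z. \<Sum>b\<in>Basis. (w \<bullet> b) * dir b G z) has_derivative (\<lambda>h. \<Sum>b\<in>Basis. (w \<bullet> b) * dir h (dir b G) z)) (at z)"
    by (intro has_derivative_sum has_derivative_mult_right smooth_on_has_derivative[OF smooth_on_dir[OF assms(2)] assms(3)])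
  then have "(dir w G has_derivative (\<lambda>h. \<Sum>b\<in>Basis. (w \<bullet> b) * dir h (dir b G) z)) (at z)"
    by (rule has_derivative_transform_within_open[OF _ assms(1,3)]) (rule dir_sum_Basis[OF assms(2), symmetric])
  from fun_cong[OF frechet_derivative_at[OF this], of v] show ?thesis by (rule sym)
qed

text \<open>The acceleration of the curve contributes the first-order term. The first derivative
  \<open>d\<close> is exposed on all of \<open>I\<close> so that it can be identified with another
  expression for the same function before differentiating again.\<close>

lemma curve_second_derivative:
  fixes G :: "'b::euclidean_space \<Rightarrow> real"
  assumes "open S" "smooth_on S G" "0 \<in> I" "\<And>\<tau>. \<tau> \<in> I \<Longrightarrow> y \<tau> \<in> S"
    and y': "\<And>\<tau>. \<tau> \<in> I \<Longrightarrow> (y has_vector_derivative y' \<tau>) (at \<tau>)"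
    and y2: "(y' has_vector_derivative y2) (at 0)"
  obtains d where "\<And>\<tau>. \<tau> \<in> I \<Longrightarrow> ((\<lambda>\<tau>. G (y \<tau>)) has_real_derivative d \<tau>) (at \<tau>)"
    "d 0 = dir (y' 0) G (y 0)"
    "(d has_real_derivative dir (y' 0) (dir (y' 0) G) (y 0) + dir y2 G (y 0)) (at 0)"
proof -
  note y0 = assms(4)[OF assms(3)]
  define d where "d \<tau> = (\<Sum>b\<in>Basis. (y' \<tau> \<bullet> b) * dir b G (y \<tau>))" for \<tau>
  have d: "d \<tau> = dir (y' \<tau>) G (y \<tau>)" if "\<tau> \<in> I" for \<tau>
    unfolding d_def by (rule dir_sum_Basis[OF assms(2) assms(4)[OF that], symmetric])
  have "((\<lambda>\<tau>. G (y \<tau>)) has_real_derivative d \<tau>) (at \<tau>)" if "\<tau> \<in> I" for \<tau>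
    unfolding d[OF that] has_real_derivative_iff_has_vector_derivative
    by (rule has_derivative_curve[OF smooth_on_has_derivative[OF assms(2) assms(4)] y'[OF that]]) (rule that)
  moreover have "d 0 = dir (y' 0) G (y 0)" using d assms(3) by blast
  moreover have "(d has_real_derivative dir (y' 0) (dir (y' 0) G) (y 0) + dir y2 G (y 0)) (at 0)"
  proof -
    have 1: "((\<lambda>\<tau>. y' \<tau> \<bullet> b) has_real_derivative y2 \<bullet> b) (at 0)" for b
      unfolding has_real_derivative_iff_has_vector_derivative
      using bounded_linear.has_vector_derivative[OF bounded_linear_inner_left y2] .
    have 2: "((\<lambda>\<tau>. dir b G (y \<tau>)) has_real_derivative dir (y' 0) (dir b G) (y 0)) (at 0)" for b
      unfolding has_real_derivative_iff_has_vector_derivative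
      by (rule has_derivative_curve[of "dir b G", OF smooth_on_has_derivative[OF smooth_on_dir[OF assms(2)] y0] y'[OF assms(3)]])
    have "(d has_real_derivative (\<Sum>b\<in>Basis. (y2 \<bullet> b) * dir b G (y 0) + dir (y' 0) (dir b G) (y 0) * (y' 0 \<bullet> b))) (at 0)"
      unfolding d_def by (intro DERIV_sum DERIV_mult 1 2)
    also have "(\<Sum>b\<in>Basis. (y2 \<bullet> b) * dir b G (y 0) + dir (y' 0) (dir b G) (y 0) * (y' 0 \<bullet> b)) =
        dir (y' 0) (dir (y' 0) G) (y 0) + dir y2 G (y 0)"
      unfolding dir_dir_sum_Basis[OF assms(1,2) y0, of "y' 0" "y' 0"] dir_sum_Basis[OF assms(2) y0, of y2]
      by (simp add: sum.distrib mult.commute)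
    finally show ?thesis .
  qed
  ultimately show ?thesis using that by blast
qed

text \<open>The middle coefficient, the sum of both mixed derivatives, is the number
  \<open>\<sigma>\<close> of \<open>image_jet\<close>.\<close>

lemma dir_dir_pair:
  fixes g :: "real \<times> real \<Rightarrow> real"
  assumes "open M" "smooth_on M g" "q \<in> M"
  shows "dir (a, b) (dir (a, b) g) q = dir (1, 0) (dir (1, 0) g) q * a\<^sup>2 +
    (dir (1, 0) (dir (0, 1) g) q + dir (0, 1) (dir (1, 0) g) q) * a * b + dir (0, 1) (dir (0, 1) g) q * b\<^sup>2"
proof -
  note lin = linear_pair[OF has_derivative_linear[OF smooth_on_has_derivative[OF smooth_on_dir[OF assms(2)] assms(3)]]]
  have "dir (a, b) (dir (a, b) g) q = a * dir (a, b) (dir (1, 0) g) q + b * dir (a, b) (dir (0, 1) g) q"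
    unfolding dir_dir_sum_Basis[OF assms, of "(a, b)" "(a, b)"] by (simp add: Basis_prod_def)
  then show ?thesis
    unfolding lin[of _ a b] by (simp add: algebra_simps power2_eq_square)
qed

lemma dir_triple:
  fixes G :: "real \<times> real \<times> real \<Rightarrow> real"
  assumes "smooth_on S G" "z \<in> S"
  shows "dir (a, b, c) G z = a * dir (1, 0, 0) G z + b * dir (0, 1, 0) G z + c * dir (0, 0, 1) G z"
  using linear_triple[OF has_derivative_linear[OF smooth_on_has_derivative[OF assms]], of a b c] by simp

text \<open>The second derivative of G in direction (0, 1, s) is quadratic in s with leading
  coefficient G_uu; its second difference over s = -1, 0, 1 is twice that coefficient.\<close>

lemma dir_dir_triple_second_difference:
  fixes G :: "real \<times> real \<times> real \<Rightarrow> real"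
  assumes "open S" "smooth_on S G" "z \<in> S"
  shows "dir (0, 1, 1) (dir (0, 1, 1) G) z + dir (0, 1, -1) (dir (0, 1, -1) G) z - 2 * dir (0, 1, 0) (dir (0, 1, 0) G) z
    = 2 * dir (0, 0, 1) (dir (0, 0, 1) G) z"
proof -
  note lin = dir_triple[OF smooth_on_dir[OF assms(2)] assms(3)]
  have "dir w (dir (a, b, c) G) z = a * dir w (dir (1, 0, 0) G) z + b * dir w (dir (0, 1, 0) G) z + c * dir w (dir (0, 0, 1) G) z" for w a b c
    unfolding dir_dir_sum_Basis[OF assms, of "(a, b, c)" w] by (simp add: Basis_prod_def zero_prod_def)
  note lin2 = this
  show ?thesis
    unfolding lin2[where a = 0 and b = 1 and c = 1] lin2[where a = 0 and b = 1 and c = "-1"]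
    unfolding lin[where a = 0 and b = 1 and c = 1] lin[where a = 0 and b = 1 and c = "-1"] by simp
qed

lemma Dx_Dx_eq_dir:
  fixes g :: "real \<times> real \<Rightarrow> real"
  assumes "smooth_on M g" "open M" "q \<in> M"
  shows "Dx (Dx g) q = dir (0, 1) (dir (0, 1) g) q"
proof -
  have "Dx (Dx g) q = Dx (dir (0, 1) g) q"
    by (rule Dt_Dx_cong[OF assms(2,3)]) (metis Dt_Dx_has_derivative(4) assms(1) prod.collapse)
  also have "\<dots> = dir (0, 1) (dir (0, 1) g) q"
    using Dt_Dx_has_derivative(4)[OF smooth_on_dir[OF assms(1)], of "fst q" "snd q"] assms(3) by simp
  finally show ?thesis .
qed

section \<open>Images of single jets\<close>

locale groupoid_element =
  fixes \<epsilon> :: real and D D' :: "(real \<times> real) set" and B B' :: "real \<times> real \<Rightarrow> real"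
    and \<Omega> :: "(real \<times> real \<times> real) set" and \<Phi> :: "real \<times> real \<times> real \<Rightarrow> real \<times> real \<times> real"
  assumes \<epsilon>: "\<epsilon> \<in> {-1, 1}" and B: "open D" "smooth_on D B" and B': "open D'" "smooth_on D' B'"
    and \<Omega>: "open \<Omega>" "base ` \<Omega> \<subseteq> D" "base ` \<Phi> ` \<Omega> \<subseteq> D'"
    and point_transformation: "is_point_transformation (\<Omega>, \<Phi>)"
    and maps: "maps_equation (\<Omega>, \<Phi>) (FP_equation \<epsilon> (D, B)) (FP_equation \<epsilon> (D', B'))"
begin

definition TT :: "real \<times> real \<times> real \<Rightarrow> real" where "TT z = fst (\<Phi> z)"
definition XX :: "real \<times> real \<times> real \<Rightarrow> real" where "XX z = fst (snd (\<Phi> z))"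
definition UU :: "real \<times> real \<times> real \<Rightarrow> real" where "UU z = snd (snd (\<Phi> z))"

lemma \<Phi>_eq: "\<Phi> z = (TT z, XX z, UU z)"
  by (simp add: TT_def XX_def UU_def)

lemma smooth_\<Phi>: "smooth_on \<Omega> \<Phi>"
proof (rule smooth_on_local[OF \<Omega>(1)])
  fix z assume "z \<in> \<Omega>"
  then obtain V \<Psi> where "open V" "z \<in> V" "V \<subseteq> \<Omega>" "smooth_on V \<Phi>"
    using point_transformation unfolding is_point_transformation_def by auto
  then show "\<exists>V. open V \<and> z \<in> V \<and> smooth_on (V \<inter> \<Omega>) \<Phi>"
    by (metis inf.absorb1)
qed

lemma smooth_components: "smooth_on \<Omega> TT" "smooth_on \<Omega> XX" "smooth_on \<Omega> UU"
  unfolding TT_def XX_def UU_def by (intro smooth_intros smooth_\<Phi> \<Omega>(1))+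

text \<open>Differentiating \<open>\<Phi> (\<Psi> y) = y\<close> on the open image gives a right
  inverse of the derivative. This is the form in which nondegeneracy of \<open>\<Phi>\<close> enters
  the arguments below.\<close>

lemma derivative_surj:
  assumes "z \<in> \<Omega>"
  obtains w where "dir w TT z = a" "dir w XX z = b" "dir w UU z = c"
proof -
  obtain V \<Psi> where V: "open V" "z \<in> V" "V \<subseteq> \<Omega>" "open (\<Phi> ` V)" "smooth_on (\<Phi> ` V) \<Psi>" "\<And>w. w \<in> V \<Longrightarrow> \<Psi> (\<Phi> w) = w"
    using point_transformation assms unfolding is_point_transformation_def by auto
  have d\<Phi>: "(\<Phi> has_derivative frechet_derivative \<Phi> (at z)) (at z)"
    by (rule smooth_on_has_derivative[OF smooth_\<Phi> assms])
  have d\<Psi>: "(\<Psi> has_derivative frechet_derivative \<Psi> (at (\<Phi> z))) (at (\<Phi> z))"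
    by (rule smooth_on_has_derivative[OF V(5)]) (use V in auto)
  have "((\<lambda>y. \<Phi> (\<Psi> y)) has_derivative (\<lambda>v. frechet_derivative \<Phi> (at z) (frechet_derivative \<Psi> (at (\<Phi> z)) v))) (at (\<Phi> z))"
    using has_derivative_compose[OF d\<Psi>, of \<Phi>] d\<Phi> V(6)[OF V(2)] by simp
  then have "((\<lambda>y. y) has_derivative (\<lambda>v. frechet_derivative \<Phi> (at z) (frechet_derivative \<Psi> (at (\<Phi> z)) v))) (at (\<Phi> z))"
    by (rule has_derivative_transform_within_open[OF _ V(4)]) (use V in auto)
  then have "frechet_derivative \<Phi> (at z) (frechet_derivative \<Psi> (at (\<Phi> z)) v) = v" for v
    using has_derivative_unique[OF has_derivative_ident] by metis
  then obtain w where w: "frechet_derivative \<Phi> (at z) w = (a, b, c)" by metis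
  have "dir w TT z = fst (frechet_derivative \<Phi> (at z) w)" "dir w XX z = fst (snd (frechet_derivative \<Phi> (at z) w))"
    "dir w UU z = snd (snd (frechet_derivative \<Phi> (at z) w))"
    unfolding TT_def XX_def UU_def
    using frechet_derivative_at[OF has_derivative_fst[OF d\<Phi>]] frechet_derivative_at[OF has_derivative_fst[OF has_derivative_snd[OF d\<Phi>]]]
      frechet_derivative_at[OF has_derivative_snd[OF has_derivative_snd[OF d\<Phi>]]] by metis+
  then show ?thesis using that w by simp
qed

text \<open>The Jacobian determinant of the map (t, x) to (T, X) restricted to the graph of a
  function with u_t = r and u_x = s. When it is nonzero, the graph is locally mapped to a
  graph.\<close>

definition total_jacobian :: "real \<Rightarrow> real \<Rightarrow> real \<times> real \<times> real \<Rightarrow> real" where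
  "total_jacobian r s z = dir (1, 0, r) TT z * dir (0, 1, s) XX z - dir (0, 1, s) TT z * dir (1, 0, r) XX z"

text \<open>The base components along the graph of \<open>f\<close> form a planar map
  \<open>F\<close> that is locally invertible at (t, x). The relation between g and the components
  of \<open>\<Phi>\<close> on a whole neighbourhood is kept, to be differentiated later.\<close>

lemma prolongation_of_jet:
  assumes z: "z = (t, x, u)" "z \<in> \<Omega>" and J: "total_jacobian r s z \<noteq> 0"
    and f: "f = (\<lambda>p. u + r * (fst p - t) + s * (snd p - x) + k / 2 * (fst p - t)\<^sup>2 + m / 2 * (snd p - x)\<^sup>2)"
  obtains N M g where "open N" "(t, x) \<in> N" "open M" "smooth_on M g" "(TT z, XX z) \<in> M"
    "\<And>p. p \<in> N \<Longrightarrow> graph_pt f p \<in> \<Omega> \<and> (TT (graph_pt f p), XX (graph_pt f p)) \<in> M \<and>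
       g (TT (graph_pt f p), XX (graph_pt f p)) = UU (graph_pt f p)"
    "(jet2 f (t, x), jet2 g (TT z, XX z)) \<in> prolongation (\<Omega>, \<Phi>)"
proof -
  have f_sm: "smooth_on UNIV f" unfolding f by (intro smooth_intros) auto
  have gp: "graph_pt f p = (fst p, snd p, f p)" for p by (cases p) simp
  have gp_sm: "smooth_on UNIV (graph_pt f)"
    unfolding gp[abs_def] by (intro smooth_intros f_sm) auto
  define N0 where "N0 = graph_pt f -` \<Omega>"
  have z_eq: "graph_pt f (t, x) = z" by (simp add: f z)
  have N0: "open N0" "(t, x) \<in> N0"
    unfolding N0_def using open_vimage[OF \<Omega>(1) smooth_on_continuous[OF gp_sm]] z_eq z(2) by auto
  define F where "F p = (TT (graph_pt f p), XX (graph_pt f p))" for p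
  have comp_sm: "smooth_on N0 (\<lambda>p. G (graph_pt f p))" if "smooth_on \<Omega> G" for G :: "_ \<Rightarrow> real"
    by (rule smooth_on_compose[OF N0(1) that _ smooth_on_subset[OF gp_sm]]) (auto simp: N0_def)
  have F_sm: "smooth_on N0 F"
    unfolding F_def by (intro smooth_intros comp_sm smooth_components N0(1))
  have comp_d: "Dt (\<lambda>p. G (graph_pt f p)) (t, x) = dir (1, 0, r) G z" "Dx (\<lambda>p. G (graph_pt f p)) (t, x) = dir (0, 1, s) G z"
    if G: "smooth_on \<Omega> G" for G :: "_ \<Rightarrow> real"
  proof -
    have "((\<lambda>\<tau>. graph_pt f (\<tau>, x)) has_vector_derivative (1, 0, r)) (at t)"
      "((\<lambda>y. graph_pt f (t, y)) has_vector_derivative (0, 1, s)) (at x)"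
      unfolding gp unfolding f
      by (intro has_vector_derivative_Pair; auto intro!: derivative_eq_intros simp flip: has_real_derivative_iff_has_vector_derivative)+
    note c = has_derivative_curve[OF smooth_on_has_derivative[OF G] this(1)] has_derivative_curve[OF smooth_on_has_derivative[OF G] this(2)]
    show "Dt (\<lambda>p. G (graph_pt f p)) (t, x) = dir (1, 0, r) G z" "Dx (\<lambda>p. G (graph_pt f p)) (t, x) = dir (0, 1, s) G z"
      using c z_eq z(2) by (auto intro!: Dt_eqI Dx_eqI simp: has_real_derivative_iff_has_vector_derivative)
  qed
  have "Dt (\<lambda>q. fst (F q)) (t, x) * Dx (\<lambda>q. snd (F q)) (t, x) - Dx (\<lambda>q. fst (F q)) (t, x) * Dt (\<lambda>q. snd (F q)) (t, x) \<noteq> 0"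
    unfolding F_def fst_conv snd_conv using J
    by (simp only: comp_d[OF smooth_components(1)] comp_d[OF smooth_components(2)] total_jacobian_def not_False_eq_True)
  from smooth_local_inverse[OF N0 F_sm this]
  obtain N M h where N: "open N" "(t, x) \<in> N" "N \<subseteq> N0" "open M" "F ` N = M" "smooth_on M h"
    and h: "\<And>s. s \<in> N \<Longrightarrow> h (F s) = s" "h ` M = N" "\<And>r. r \<in> M \<Longrightarrow> F (h r) = r" by metis
  \<comment> \<open>Return to the source base point, lift to the graph of \<open>f\<close>, and read
    off the last component of the image.\<close>
  define g where "g q = UU (graph_pt f (h q))" for q
  have g_sm: "smooth_on M g"
    unfolding g_def using smooth_on_compose[OF N(4) comp_sm[OF smooth_components(3)] _ N(6)] h(2) N(3) by auto
  have gN: "graph_pt f p \<in> \<Omega> \<and> F p \<in> M \<and> g (F p) = UU (graph_pt f p)" if "p \<in> N" for p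
    using N(3,5) h(1)[OF that] that by (auto simp: N0_def g_def)
  have \<Phi>g: "\<Phi> (graph_pt f p) = graph_pt g (F p)" if "p \<in> N" for p
    using gN[OF that] by (simp add: \<Phi>_eq F_def)
  have "(jet2 f (t, x), jet2 g (F (t, x))) \<in> prolongation (\<Omega>, \<Phi>)"
    unfolding prolongation_def prod.case mem_Collect_eq
    by (intro exI[of _ f] exI[of _ "(t, x)"] exI[of _ g] exI[of _ "F (t, x)"] exI[of _ N] exI[of _ M] conjI refl)
      (use N gN \<Phi>g g_sm smooth_on_subset[OF f_sm] in auto)
  moreover have "F (t, x) = (TT z, XX z)" unfolding F_def z_eq ..
  ultimately show ?thesis
    using that[of N M g] N gN g_sm unfolding F_def by (metis (no_types, lifting))
qed

end

lemma quadratic_derivatives: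
  assumes "f = (\<lambda>p. u + r * (fst p - t) + s * (snd p - x) + k / 2 * (fst p - t)\<^sup>2 + m / 2 * (snd p - x)\<^sup>2)"
  shows "f (t, x) = u" and "Dt f (t, x) = r" and "Dx f (t, x) = s" and "Dx (Dx f) (t, x) = m"
proof -
  have fx: "Dx f = (\<lambda>p. s + m * (snd p - x))"
    by (rule ext, case_tac p, simp only:, rule Dx_eqI) (auto simp: assms intro!: derivative_eq_intros)
  then show "Dx f (t, x) = s" by simp
  show "Dt f (t, x) = r" by (rule Dt_eqI) (auto simp: assms intro!: derivative_eq_intros)
  show "Dx (Dx f) (t, x) = m" unfolding fx by (rule Dx_eqI) (auto intro!: derivative_eq_intros)
qed (simp add: assms)

context groupoid_element
begin

text \<open>
  The jet at \<open>z\<close> with \<open>(u\<^sub>t, u\<^sub>x, u\<^sub>t\<^sub>t, u\<^sub>t\<^sub>x, u\<^sub>x\<^sub>x) = (r, s, k, 0, m)\<close> has an image with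
  first derivatives \<open>g1, g2\<close> and second derivatives \<open>g11, \<sigma> / 2, g22\<close>: both are compared along the
  lines through the base point with direction \<open>(v1, v2)\<close>.
\<close>

definition image_jet ::
  "real \<Rightarrow> real \<Rightarrow> real \<Rightarrow> real \<Rightarrow> real \<times> real \<times> real \<Rightarrow> real \<Rightarrow> real \<Rightarrow> real \<Rightarrow> real \<Rightarrow> real \<Rightarrow> bool" where
  "image_jet r s k m z g1 g2 g11 \<sigma> g22 \<longleftrightarrow> (\<forall>v1 v2 w q.
     w = (v1, v2, r * v1 + s * v2) \<longrightarrow> q = k * v1\<^sup>2 + m * v2\<^sup>2 \<longrightarrow>
     dir w UU z = g1 * dir w TT z + g2 * dir w XX z \<and>
     dir w (dir w UU) z + q * dir (0, 0, 1) UU z =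
       g11 * (dir w TT z)\<^sup>2 + \<sigma> * dir w TT z * dir w XX z + g22 * (dir w XX z)\<^sup>2 +
       g1 * (dir w (dir w TT) z + q * dir (0, 0, 1) TT z) + g2 * (dir w (dir w XX) z + q * dir (0, 0, 1) XX z))"

lemma image_jetD:
  assumes "image_jet r s k m z g1 g2 g11 \<sigma> g22" and "w = (v1, v2, r * v1 + s * v2)"
  shows "dir w UU z = g1 * dir w TT z + g2 * dir w XX z"
    and "q = k * v1\<^sup>2 + m * v2\<^sup>2 \<Longrightarrow> dir w (dir w UU) z + q * dir (0, 0, 1) UU z =
       g11 * (dir w TT z)\<^sup>2 + \<sigma> * dir w TT z * dir w XX z + g22 * (dir w XX z)\<^sup>2 +
       g1 * (dir w (dir w TT) z + q * dir (0, 0, 1) TT z) + g2 * (dir w (dir w XX) z + q * dir (0, 0, 1) XX z)"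
  using assms unfolding image_jet_def by blast+

text \<open>Differentiating g(T, X) = U twice along curves in the graph of \<open>f\<close> gives
  \<open>image_jet\<close>. The second conclusion is the target equation, which holds because the
  source jet satisfies its own equation.\<close>

lemma jet_relations:
  assumes z: "z = (t, x, u)" "z \<in> \<Omega>" and J: "total_jacobian r s z \<noteq> 0"
    and solution: "r = \<epsilon> * m + B (t, x) * s + Dx B (t, x) * u"
  obtains g1 g2 g11 \<sigma> g22 where "image_jet r s k m z g1 g2 g11 \<sigma> g22"
    "g1 = \<epsilon> * g22 + B' (TT z, XX z) * g2 + Dx B' (TT z, XX z) * UU z"
proof -
  define f where "f = (\<lambda>p. u + r * (fst p - t) + s * (snd p - x) + k / 2 * (fst p - t)\<^sup>2 + m / 2 * (snd p - x)\<^sup>2)"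
  obtain N M g where N: "open N" "(t, x) \<in> N" and M: "open M" "smooth_on M g" "(TT z, XX z) \<in> M"
    and gN: "\<And>p. p \<in> N \<Longrightarrow> graph_pt f p \<in> \<Omega> \<and> (TT (graph_pt f p), XX (graph_pt f p)) \<in> M \<and>
       g (TT (graph_pt f p), XX (graph_pt f p)) = UU (graph_pt f p)"
    and pr: "(jet2 f (t, x), jet2 g (TT z, XX z)) \<in> prolongation (\<Omega>, \<Phi>)"
    using prolongation_of_jet[OF z J f_def] by metis
  define q where "q = (TT z, XX z)"
  define g1 g2 g11 \<sigma> g22 where "g1 = dir (1, 0) g q" and "g2 = dir (0, 1) g q" and "g11 = dir (1, 0) (dir (1, 0) g) q"
    and "\<sigma> = dir (1, 0) (dir (0, 1) g) q + dir (0, 1) (dir (1, 0) g) q" and "g22 = dir (0, 1) (dir (0, 1) g) q"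
  note g_defs = g1_def g2_def g11_def \<sigma>_def g22_def
  have qM: "q \<in> M" using M q_def by simp
  have main: "dir w UU z = g1 * dir w TT z + g2 * dir w XX z \<and>
       dir w (dir w UU) z + l * dir (0, 0, 1) UU z =
       g11 * (dir w TT z)\<^sup>2 + \<sigma> * dir w TT z * dir w XX z + g22 * (dir w XX z)\<^sup>2 +
       g1 * (dir w (dir w TT) z + l * dir (0, 0, 1) TT z) + g2 * (dir w (dir w XX) z + l * dir (0, 0, 1) XX z)"
    if w: "w = (v1, v2, r * v1 + s * v2)" and l: "l = k * v1\<^sup>2 + m * v2\<^sup>2" for v1 v2 w l
  proof -
    \<comment> \<open>The straight line with direction (v1, v2), lifted to the graph. As
      \<open>f\<close> is quadratic, its acceleration is the constant vector (0, 0, l).\<close>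
    define c where "c \<tau> = graph_pt f (t + \<tau> * v1, x + \<tau> * v2)" for \<tau>
    define c' where "c' \<tau> = (v1, v2, r * v1 + s * v2 + \<tau> * l)" for \<tau>
    have c_eq: "c \<tau> = (t + \<tau> * v1, x + \<tau> * v2, u + \<tau> * (r * v1 + s * v2) + \<tau>\<^sup>2 / 2 * l)" for \<tau>
      by (simp add: c_def f_def l field_simps power2_eq_square)
    define I where "I = (\<lambda>\<tau>. (t + \<tau> * v1, x + \<tau> * v2)) -` N"
    have I: "open I" "0 \<in> I"
      unfolding I_def using N by (auto intro!: open_vimage continuous_intros)
    have c\<Omega>: "c \<tau> \<in> \<Omega>" "(TT (c \<tau>), XX (c \<tau>)) \<in> M" "g (TT (c \<tau>), XX (c \<tau>)) = UU (c \<tau>)" if "\<tau> \<in> I" for \<tau>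
      using gN[of "(t + \<tau> * v1, x + \<tau> * v2)"] that unfolding I_def c_def by simp_all
    have c0: "c 0 = z" "c' 0 = w" by (simp_all add: c_eq c'_def z w)
    have dc: "(c has_vector_derivative c' \<tau>) (at \<tau>)" for \<tau>
      unfolding c_eq[abs_def] c'_def
      by (intro has_vector_derivative_Pair; auto intro!: derivative_eq_intros simp flip: has_real_derivative_iff_has_vector_derivative)
    have dc': "(c' has_vector_derivative (0, 0, l)) (at 0)"
      unfolding c'_def[abs_def]
      by (intro has_vector_derivative_Pair; auto intro!: derivative_eq_intros simp flip: has_real_derivative_iff_has_vector_derivative)
    have *: "\<exists>d. (\<forall>\<tau>\<in>I. ((\<lambda>\<tau>. G (c \<tau>)) has_real_derivative d \<tau>) (at \<tau>)) \<and> d 0 = dir w G z \<and>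
        (d has_real_derivative dir w (dir w G) z + l * dir (0, 0, 1) G z) (at 0)" if G: "smooth_on \<Omega> G" for G :: "_ \<Rightarrow> real"
    proof -
      have "dir (0, 0, l) G z = l * dir (0, 0, 1) G z"
        using dir_triple[OF G z(2), of 0 0 l] by simp
      then show ?thesis
        using curve_second_derivative[OF \<Omega>(1) G I(2) c\<Omega>(1) dc dc', unfolded c0] by metis
    qed
    obtain dT where dT: "\<And>\<tau>. \<tau> \<in> I \<Longrightarrow> ((\<lambda>\<tau>. TT (c \<tau>)) has_real_derivative dT \<tau>) (at \<tau>)" "dT 0 = dir w TT z"
      "(dT has_real_derivative dir w (dir w TT) z + l * dir (0, 0, 1) TT z) (at 0)"
      using *[OF smooth_components(1)] by metis
    obtain dX where dX: "\<And>\<tau>. \<tau> \<in> I \<Longrightarrow> ((\<lambda>\<tau>. XX (c \<tau>)) has_real_derivative dX \<tau>) (at \<tau>)" "dX 0 = dir w XX z"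
      "(dX has_real_derivative dir w (dir w XX) z + l * dir (0, 0, 1) XX z) (at 0)"
      using *[OF smooth_components(2)] by metis
    obtain dU where dU: "\<And>\<tau>. \<tau> \<in> I \<Longrightarrow> ((\<lambda>\<tau>. UU (c \<tau>)) has_real_derivative dU \<tau>) (at \<tau>)" "dU 0 = dir w UU z"
      "(dU has_real_derivative dir w (dir w UU) z + l * dir (0, 0, 1) UU z) (at 0)"
      using *[OF smooth_components(3)] by metis
    define y where "y \<tau> = (TT (c \<tau>), XX (c \<tau>))" for \<tau>
    define y' where "y' \<tau> = (dT \<tau>, dX \<tau>)" for \<tau>
    define y2 where "y2 = (dir w (dir w TT) z + l * dir (0, 0, 1) TT z, dir w (dir w XX) z + l * dir (0, 0, 1) XX z)"
    have y: "(y has_vector_derivative y' \<tau>) (at \<tau>)" if "\<tau> \<in> I" for \<tau>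
      unfolding y_def[abs_def] y'_def using dT(1)[OF that] dX(1)[OF that]
      by (intro has_vector_derivative_Pair) (simp_all add: has_real_derivative_iff_has_vector_derivative)
    have y2: "(y' has_vector_derivative y2) (at 0)"
      unfolding y'_def[abs_def] y2_def using dT(3) dX(3)
      by (intro has_vector_derivative_Pair) (simp_all add: has_real_derivative_iff_has_vector_derivative)
    have yM: "y \<tau> \<in> M" if "\<tau> \<in> I" for \<tau> unfolding y_def using c\<Omega>(2) that .
    have y0: "y 0 = q" "y' 0 = (dir w TT z, dir w XX z)"
      by (simp_all add: y_def y'_def c0 q_def dT(2) dX(2))
    obtain dg where dg: "\<And>\<tau>. \<tau> \<in> I \<Longrightarrow> ((\<lambda>\<tau>. g (y \<tau>)) has_real_derivative dg \<tau>) (at \<tau>)" "dg 0 = dir (y' 0) g q"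
      "(dg has_real_derivative dir (y' 0) (dir (y' 0) g) q + dir y2 g q) (at 0)"
      using curve_second_derivative[OF M(1,2) I(2) yM y y2, unfolded y0(1)] by metis
    \<comment> \<open>Equality on all of \<open>I\<close>, and not just at 0, is what permits a
      second differentiation.\<close>
    have eq: "dg \<tau> = dU \<tau>" if "\<tau> \<in> I" for \<tau>
    proof -
      have "((\<lambda>\<tau>. UU (c \<tau>)) has_real_derivative dg \<tau>) (at \<tau>)"
        by (rule has_field_derivative_transform_within_open[OF dg(1)[OF that] I(1) that]) (simp add: y_def c\<Omega>(3))
      then show ?thesis using dU(1)[OF that] DERIV_unique by blast
    qed
    note g_lin = linear_pair[OF has_derivative_linear[OF smooth_on_has_derivative[OF M(2) qM]]]
    have "dir w UU z = g1 * dir w TT z + g2 * dir w XX z"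
      using eq[OF I(2)] dg(2) dU(2) g_lin[of "dir w TT z" "dir w XX z"] by (simp add: y0 g_defs mult.commute)
    moreover have "(dg has_real_derivative dir w (dir w UU) z + l * dir (0, 0, 1) UU z) (at 0)"
      by (rule has_field_derivative_transform_within_open[OF dU(3) I]) (simp add: eq)
    then have "dir w (dir w UU) z + l * dir (0, 0, 1) UU z = dir (y' 0) (dir (y' 0) g) q + dir y2 g q"
      using dg(3) DERIV_unique by blast
    moreover have "dir (y' 0) (dir (y' 0) g) q =
        g11 * (dir w TT z)\<^sup>2 + \<sigma> * dir w TT z * dir w XX z + g22 * (dir w XX z)\<^sup>2"
      unfolding y0 g_defs by (rule dir_dir_pair[OF M(1,2) qM])
    moreover have "dir y2 g q = g1 * (dir w (dir w TT) z + l * dir (0, 0, 1) TT z) + g2 * (dir w (dir w XX) z + l * dir (0, 0, 1) XX z)"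
      unfolding y2_def g_defs by (subst g_lin) (simp add: mult.commute)
    ultimately show ?thesis by simp
  qed
  have "z \<in> \<Omega>" "base z = (t, x)" "base (\<Phi> z) = q" using z by (simp_all add: \<Phi>_eq q_def)
  then have DD': "(t, x) \<in> D" "q \<in> D'" using \<Omega>(2,3) by (metis imageI subsetD)+
  have "FP_residual \<epsilon> B f (t, x) = r - \<epsilon> * m - B (t, x) * s - Dx B (t, x) * u"
    by (simp add: FP_residual_def quadratic_derivatives[OF f_def])
  moreover have "g q = UU z" using gN[OF N(2)] by (simp add: f_def q_def z)
  then have "FP_residual \<epsilon> B' g q = g1 - \<epsilon> * g22 - B' q * g2 - Dx B' q * UU z"
    using Dt_Dx_has_derivative(3,4)[OF M(2), of "fst q" "snd q"] Dx_Dx_eq_dir[OF M(2,1) qM] qM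
    by (simp add: FP_residual_def g_defs)
  moreover have "FP_residual \<epsilon> B f (t, x) = 0 \<longleftrightarrow> FP_residual \<epsilon> B' g q = 0"
  proof -
    have "jet2 f (t, x) \<in> FP_equation \<epsilon> (D, B) \<longleftrightarrow> jet2 g q \<in> FP_equation \<epsilon> (D', B')"
      using maps pr unfolding maps_equation_def q_def by blast
    then show ?thesis unfolding jet2_in_FP_equation using DD' by blast
  qed
  ultimately have "g1 = \<epsilon> * g22 + B' q * g2 + Dx B' q * UU z"
    using solution by auto
  then have E: "g1 = \<epsilon> * g22 + B' (TT z, XX z) * g2 + Dx B' (TT z, XX z) * UU z"
    unfolding q_def .
  have J: "image_jet r s k m z g1 g2 g11 \<sigma> g22"
    unfolding image_jet_def using main by blast
  show ?thesis by (rule that[OF J E])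
qed

section \<open>Pointwise shape of the transformation\<close>

lemma transversal:
  assumes "z \<in> \<Omega>"
    and rel: "image_jet r s k m z g1 g2 g11 \<sigma> g22"
  shows "dir (0, 0, 1) UU z \<noteq> g1 * dir (0, 0, 1) TT z + g2 * dir (0, 0, 1) XX z"
proof
  assume eq: "dir (0, 0, 1) UU z = g1 * dir (0, 0, 1) TT z + g2 * dir (0, 0, 1) XX z"
  \<comment> \<open>The relation dU = g1 dT + g2 dX holds on the tangent plane of the graph. With
    \<open>eq\<close> it would extend to the vertical direction, hence to all directions, including
    this \<open>w\<close> that kills dT and dX but not dU.\<close>
  obtain w where w: "dir w TT z = 0" "dir w XX z = 0" "dir w UU z = 1"
    using derivative_surj[OF assms(1)] .
  obtain a b c where abc: "w = (a, b, c)" by (cases w)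
  have split: "dir w G z = dir (a, b, r * a + s * b) G z + (c - r * a - s * b) * dir (0, 0, 1) G z"
    if "smooth_on \<Omega> G" for G :: "_ \<Rightarrow> real"
    unfolding abc dir_triple[OF that assms(1), of a b c] dir_triple[OF that assms(1), of a b "r * a + s * b"]
    by (simp add: algebra_simps)
  have "dir w UU z = g1 * dir w TT z + g2 * dir w XX z"
    unfolding split[OF smooth_components(1)] split[OF smooth_components(2)] split[OF smooth_components(3)]
      image_jetD(1)[OF rel refl] eq by (simp add: algebra_simps)
  then show False using w by simp
qed

lemma total_jacobian_affine:
  assumes "z \<in> \<Omega>"
  shows "total_jacobian r s z =
    (dir (1, 0, 0) TT z + r * dir (0, 0, 1) TT z) * (dir (0, 1, 0) XX z + s * dir (0, 0, 1) XX z)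
    - (dir (0, 1, 0) TT z + s * dir (0, 0, 1) TT z) * (dir (1, 0, 0) XX z + r * dir (0, 0, 1) XX z)"
  unfolding total_jacobian_def
  unfolding dir_triple[OF smooth_components(1) assms, of 1 0 r] dir_triple[OF smooth_components(1) assms, of 0 1 s]
    dir_triple[OF smooth_components(2) assms, of 1 0 r] dir_triple[OF smooth_components(2) assms, of 0 1 s] by simp

text \<open>Two jets of solutions that differ only in \<open>u\<^sub>t\<^sub>t\<close> have images with the same
  \<open>u\<^sub>x\<^sub>x\<close>, because the target equation determines it.\<close>

lemma TT_tangential:
  assumes "z \<in> \<Omega>" and J: "total_jacobian r s z \<noteq> 0"
  shows "dir (0, 1, s) TT z = 0"
proof (rule ccontr)
  assume nz: "dir (0, 1, s) TT z \<noteq> 0"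
  obtain t x u where z: "z = (t, x, u)" by (cases z)
  \<comment> \<open>The source equation solved for u_xx; \<epsilon> is its own inverse.\<close>
  define m where "m = \<epsilon> * (r - B (t, x) * s - Dx B (t, x) * u)"
  have m: "r = \<epsilon> * m + B (t, x) * s + Dx B (t, x) * u" using \<epsilon> by (auto simp: m_def)
  obtain g1 g2 g11 \<sigma> g22 where G0: "image_jet r s 0 m z g1 g2 g11 \<sigma> g22"
    and G3: "g1 = \<epsilon> * g22 + B' (TT z, XX z) * g2 + Dx B' (TT z, XX z) * UU z"
    by (rule jet_relations[OF z assms m, of 0]) (rule that)
  note G = image_jetD[OF G0] G3
  obtain h1 h2 h11 \<upsilon> h22 where H0: "image_jet r s 1 m z h1 h2 h11 \<upsilon> h22"
    and H3: "h1 = \<epsilon> * h22 + B' (TT z, XX z) * h2 + Dx B' (TT z, XX z) * UU z"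
    by (rule jet_relations[OF z assms m, of 1]) (rule that)
  note H = image_jetD[OF H0] H3
  define a1 b1 a2 b2 where "a1 = dir (1, 0, r) TT z" and "b1 = dir (1, 0, r) XX z"
    and "a2 = dir (0, 1, s) TT z" and "b2 = dir (0, 1, s) XX z"
  note abs = a1_def b1_def a2_def b2_def
  have J': "a1 * b2 - a2 * b1 \<noteq> 0" using J by (simp add: total_jacobian_def abs)
  \<comment> \<open>The first derivatives of both images solve the same linear system, whose
    determinant is the total Jacobian.\<close>
  have "(h1 - g1) * a1 + (h2 - g2) * b1 = 0" "(h1 - g1) * a2 + (h2 - g2) * b2 = 0"
    using G(1)[of "(1, 0, r)" 1 0] H(1)[of "(1, 0, r)" 1 0] G(1)[of "(0, 1, s)" 0 1] H(1)[of "(0, 1, s)" 0 1]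
    by (simp_all add: abs left_diff_distrib)
  then have "(h1 - g1) * (a1 * b2 - a2 * b1) = 0" "(h2 - g2) * (a1 * b2 - a2 * b1) = 0" by algebra+
  then have h: "h1 = g1" "h2 = g2" using J' by auto
  then have h22: "h22 = g22" using G(3) H(3) \<epsilon> by auto
  define \<kappa> where "\<kappa> = dir (0, 0, 1) UU z - g1 * dir (0, 0, 1) TT z - g2 * dir (0, 0, 1) XX z"
  have "dir (0, 0, 1) UU z \<noteq> g1 * dir (0, 0, 1) TT z + g2 * dir (0, 0, 1) XX z"
    by (rule transversal[OF assms(1), of r s]) (rule G0)
  then have "\<kappa> \<noteq> 0" by (simp add: \<kappa>_def)
  \<comment> \<open>The right side is \<open>dir w TT z\<close> times a linear form in v. If a2 is
    nonzero, that form vanishes at v = (0, 1), so it is a multiple of v1; then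
    \<open>dir w TT z\<close> must be a multiple of v1 as well, which says a2 = 0. The directions
    (1, 0), (0, 1), (1, 1) suffice to extract the contradiction.\<close>
  have diff: "v1\<^sup>2 * \<kappa> = (h11 - g11) * (dir w TT z)\<^sup>2 + (\<upsilon> - \<sigma>) * dir w TT z * dir w XX z"
    if w: "w = (v1, v2, r * v1 + s * v2)" for v1 v2 w
    using G(2)[OF w refl] H(2)[OF w refl] unfolding h h22 \<kappa>_def by algebra
  have 1: "\<kappa> = (h11 - g11) * a1\<^sup>2 + (\<upsilon> - \<sigma>) * a1 * b1" using diff[of "(1, 0, r)" 1 0] by (simp add: abs)
  have 2: "0 = (h11 - g11) * a2\<^sup>2 + (\<upsilon> - \<sigma>) * a2 * b2" using diff[of "(0, 1, s)" 0 1] by (simp add: abs)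
  have lin: "dir (1, 1, r + s) F z = dir (1, 0, r) F z + dir (0, 1, s) F z" if "smooth_on \<Omega> F" for F :: "_ \<Rightarrow> real"
    unfolding dir_triple[OF that assms(1), of 1 1 "r + s"] dir_triple[OF that assms(1), of 1 0 r] dir_triple[OF that assms(1), of 0 1 s]
    by (simp add: algebra_simps)
  have 3: "\<kappa> = (h11 - g11) * (a1 + a2)\<^sup>2 + (\<upsilon> - \<sigma>) * (a1 + a2) * (b1 + b2)"
    using diff[of "(1, 1, r + s)" 1 1] by (simp add: lin[OF smooth_components(1)] lin[OF smooth_components(2)] abs)
  have "a2 \<noteq> 0" using nz by (simp add: abs)
  from 2 have "a2 * ((h11 - g11) * a2 + (\<upsilon> - \<sigma>) * b2) = 0" by algebra
  then have 4: "(h11 - g11) * a2 + (\<upsilon> - \<sigma>) * b2 = 0" using \<open>a2 \<noteq> 0\<close> by simp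
  from 1 2 3 4 have "(\<upsilon> - \<sigma>) * (a1 * b2 - a2 * b1) = 0" by algebra
  then have "\<upsilon> - \<sigma> = 0" using J' by simp
  with 4 \<open>a2 \<noteq> 0\<close> have "h11 - g11 = 0" by simp
  with 1 \<open>\<upsilon> - \<sigma> = 0\<close> \<open>\<kappa> \<noteq> 0\<close> show False by simp
qed

text \<open>The total Jacobian is affine in (r, s), and its coefficients are the 2 x 2 minors of
  d(T, X), not all zero by surjectivity. So it is nonzero for enough slopes s, and T_x + s T_u = 0
  at two of them gives T_x = T_u = 0.\<close>

lemma TT_spatial:
  assumes z: "z \<in> \<Omega>"
  shows "dir (0, 1, 0) TT z = 0" and "dir (0, 0, 1) TT z = 0"
    and "dir (1, 0, 0) TT z \<noteq> 0"
    and "dir (0, 1, 0) XX z \<noteq> 0 \<or> dir (0, 0, 1) XX z \<noteq> 0"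
proof -
  define Tt Tx Tu where "Tt = dir (1, 0, 0) TT z" and "Tx = dir (0, 1, 0) TT z" and "Tu = dir (0, 0, 1) TT z"
  define Xt Xx Xu where "Xt = dir (1, 0, 0) XX z" and "Xx = dir (0, 1, 0) XX z" and "Xu = dir (0, 0, 1) XX z"
  note defs = Tt_def Tx_def Tu_def Xt_def Xx_def Xu_def
  define c0 c1 c2 where "c0 = Tt * Xx - Tx * Xt" and "c1 = Tu * Xx - Tx * Xu" and "c2 = Tt * Xu - Tu * Xt"
  have J: "total_jacobian r s z = c0 + c1 * r + c2 * s" for r s
    unfolding total_jacobian_affine[OF z] c0_def c1_def c2_def defs[symmetric] by algebra
  have tang: "Tx + s * Tu = 0" if "c0 + c1 * r + c2 * s \<noteq> 0" for r s
    using TT_tangential[OF z, of r s] that dir_triple[OF smooth_components(1) z, of 0 1 s] by (simp add: J defs)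
  have minors: "\<not> (c0 = 0 \<and> c1 = 0 \<and> c2 = 0)"
  proof
    assume c: "c0 = 0 \<and> c1 = 0 \<and> c2 = 0"
    obtain w where w: "dir w TT z = 1" "dir w XX z = 0" using derivative_surj[OF z] by metis
    obtain w' where w': "dir w' TT z = 0" "dir w' XX z = 1" using derivative_surj[OF z] by metis
    obtain a b c a' b' c' where abc: "w = (a, b, c)" "w' = (a', b', c')" by (cases w, cases w')
    have "a * Tt + b * Tx + c * Tu = 1" "a * Xt + b * Xx + c * Xu = 0"
      "a' * Tt + b' * Tx + c' * Tu = 0" "a' * Xt + b' * Xx + c' * Xu = 1"
      using w w' unfolding abc defs
      using dir_triple[OF smooth_components(1) z, of a b c] dir_triple[OF smooth_components(2) z, of a b c]
        dir_triple[OF smooth_components(1) z, of a' b' c'] dir_triple[OF smooth_components(2) z, of a' b' c'] by simp_all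
    with c show False unfolding c0_def c1_def c2_def by algebra
  qed
  have "Tx = 0 \<and> Tu = 0"
  proof (cases "c1 = 0")
    case False
    \<comment> \<open>For each s, this r makes the total Jacobian equal to 1.\<close>
    have "Tx + s * Tu = 0" for s
      by (rule tang[of "(1 - c0 - c2 * s) / c1"]) (use False in simp)
    from this[of 0] this[of 1] show ?thesis by simp
  next
    case True
    \<comment> \<open>A nonzero affine function of s has at most one root, so at least two of the
      samples 0, 1, 2 give an equation for Tx and Tu.\<close>
    have "c0 = 0 \<or> Tx = 0" "c0 + c2 = 0 \<or> Tx + Tu = 0" "c0 + c2 * 2 = 0 \<or> Tx + 2 * Tu = 0"
      using tang[of 0 0] tang[of 0 1] tang[of 0 2] by auto
    then show ?thesis using minors True by auto
  qed
  then show "dir (0, 1, 0) TT z = 0" "dir (0, 0, 1) TT z = 0"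
    "dir (1, 0, 0) TT z \<noteq> 0" "dir (0, 1, 0) XX z \<noteq> 0 \<or> dir (0, 0, 1) XX z \<noteq> 0"
    using minors unfolding c0_def c1_def c2_def by (auto simp: defs)
qed

lemma TT_dir:
  assumes "z \<in> \<Omega>"
  shows "dir (a, b, c) TT z = a * dir (1, 0, 0) TT z"
  using dir_triple[OF smooth_components(1) assms, of a b c] TT_spatial[OF assms] by simp

lemma TT_dir_dir:
  assumes "z \<in> \<Omega>"
  shows "dir (0, 1, s) (dir (0, 1, s) TT) z = 0"
proof -
  have "(dir (0, 1, s) TT has_derivative (\<lambda>h. 0)) (at z)"
    by (rule has_derivative_transform_within_open[OF has_derivative_const \<Omega>(1) assms])
      (simp add: TT_dir[of _ 0 1 s])
  from fun_cong[OF frechet_derivative_at[OF this], of "(0, 1, s)"] show ?thesis by simp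
qed

text \<open>Compare solution jets differing by \<epsilon> in u_t and by 1 in u_xx. As T_x = T_u = 0,
  their images have the same x-slope, and the first-order relations give \<epsilon> \<kappa> = (h1 -
  g1) T_t. The target equation gives h1 - g1 = \<epsilon> (h22 - g22), and the second-order relation
  along (0, 1, s) gives \<kappa> = (h22 - g22) \<open>bx\<^sup>2\<close>. Transversality makes
  \<kappa> nonzero, so T_t = \<open>bx\<^sup>2\<close>.\<close>

lemma XX_tangential:
  assumes z\<Omega>: "z \<in> \<Omega>" and bx: "dir (0, 1, s) XX z \<noteq> 0"
  shows "(dir (0, 1, s) XX z)\<^sup>2 = dir (1, 0, 0) TT z"
proof -
  obtain t x u where z: "z = (t, x, u)" by (cases z)
  define Tt where "Tt = dir (1, 0, 0) TT z"
  have T_dir: "dir (0, 1, s') TT z = 0" "dir (1, 0, r') TT z = Tt" for r' s'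
    using TT_dir[OF z\<Omega>, of 0 1 s'] TT_dir[OF z\<Omega>, of 1 0 r'] by (simp_all add: Tt_def)
  have Tt: "Tt \<noteq> 0" using TT_spatial(3)[OF z\<Omega>] by (simp add: Tt_def)
  define r where "r = B (t, x) * s + Dx B (t, x) * u"
  have E: "r = \<epsilon> * 0 + B (t, x) * s + Dx B (t, x) * u" "r + \<epsilon> = \<epsilon> * 1 + B (t, x) * s + Dx B (t, x) * u"
    by (simp_all add: r_def)
  have J: "total_jacobian r s z \<noteq> 0" for r
    unfolding total_jacobian_def using T_dir Tt bx by simp
  obtain g1 g2 g11 \<sigma> g22 where G0: "image_jet r s 0 0 z g1 g2 g11 \<sigma> g22"
    and G3: "g1 = \<epsilon> * g22 + B' (TT z, XX z) * g2 + Dx B' (TT z, XX z) * UU z"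
    by (rule jet_relations[OF z z\<Omega> J E(1), of 0]) (rule that)
  note G = image_jetD[OF G0] G3
  obtain h1 h2 h11 \<upsilon> h22 where H0: "image_jet (r + \<epsilon>) s 0 1 z h1 h2 h11 \<upsilon> h22"
    and H3: "h1 = \<epsilon> * h22 + B' (TT z, XX z) * h2 + Dx B' (TT z, XX z) * UU z"
    by (rule jet_relations[OF z z\<Omega> J E(2), of 0]) (rule that)
  note H = image_jetD[OF H0] H3
  define bx where "bx = dir (0, 1, s) XX z"
  define \<kappa> where "\<kappa> = dir (0, 0, 1) UU z - g2 * dir (0, 0, 1) XX z"
  have "dir (0, 0, 1) UU z \<noteq> g1 * dir (0, 0, 1) TT z + g2 * dir (0, 0, 1) XX z"
    by (rule transversal[OF z\<Omega>, of r s]) (rule G0)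
  then have "\<kappa> \<noteq> 0" using TT_spatial(2)[OF z\<Omega>] by (simp add: \<kappa>_def)
  have "g2 * bx = h2 * bx"
    using G(1)[of "(0, 1, s)" 0 1] H(1)[of "(0, 1, s)" 0 1] T_dir by (auto simp: bx_def)
  then have h2: "h2 = g2" using bx by (simp add: bx_def)
  have lin: "dir (1, 0, r + \<epsilon>) F z = dir (1, 0, r) F z + \<epsilon> * dir (0, 0, 1) F z" if "smooth_on \<Omega> F" for F :: "_ \<Rightarrow> real"
    unfolding dir_triple[OF that z\<Omega>, of 1 0 r] dir_triple[OF that z\<Omega>, of 1 0 "r + \<epsilon>"] by (simp add: algebra_simps)
  have "dir (1, 0, r) UU z = g1 * Tt + g2 * dir (1, 0, r) XX z"
    using G(1)[of "(1, 0, r)" 1 0] T_dir by simp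
  moreover have "dir (1, 0, r) UU z + \<epsilon> * dir (0, 0, 1) UU z = h1 * Tt + g2 * (dir (1, 0, r) XX z + \<epsilon> * dir (0, 0, 1) XX z)"
    using H(1)[of "(1, 0, r + \<epsilon>)" 1 0] T_dir h2 lin[OF smooth_components(2)] lin[OF smooth_components(3)] by simp
  ultimately have "\<epsilon> * \<kappa> = (h1 - g1) * Tt" unfolding \<kappa>_def by algebra
  moreover have "h1 - g1 = \<epsilon> * (h22 - g22)" using G(3) H(3) h2 by (simp add: algebra_simps)
  ultimately have 1: "\<kappa> = (h22 - g22) * Tt" using \<epsilon> by auto
  have 2: "\<kappa> = (h22 - g22) * bx\<^sup>2"
    using G(2)[of "(0, 1, s)" 0 1 0] H(2)[of "(0, 1, s)" 0 1 1] T_dir TT_spatial(2)[OF z\<Omega>] h2 TT_dir_dir[OF z\<Omega>]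
    by (simp add: \<kappa>_def bx_def algebra_simps)
  from 1 2 \<open>\<kappa> \<noteq> 0\<close> show ?thesis by (auto simp: bx_def Tt_def)
qed

lemma XX_spatial:
  assumes z: "z \<in> \<Omega>"
  shows "dir (0, 0, 1) XX z = 0" and "dir (0, 1, 0) XX z \<noteq> 0"
    and "(dir (0, 1, 0) XX z)\<^sup>2 = dir (1, 0, 0) TT z" and "dir (0, 0, 1) UU z \<noteq> 0"
proof -
  define Xx Xu where "Xx = dir (0, 1, 0) XX z" and "Xu = dir (0, 0, 1) XX z"
  have sq: "(Xx + s * Xu)\<^sup>2 = dir (1, 0, 0) TT z" if "Xx + s * Xu \<noteq> 0" for s
    using XX_tangential[OF z, of s] that dir_triple[OF smooth_components(2) z, of 0 1 s] by (simp add: Xx_def Xu_def)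
  have Xu: "Xu = 0"
  proof (rule ccontr)
    assume nz: "Xu \<noteq> 0"
    \<comment> \<open>If X_u were nonzero, X_x + s X_u could be given the values 1 and 2, with
      different squares.\<close>
    have "1\<^sup>2 = dir (1, 0, 0) TT z" using sq[of "(1 - Xx) / Xu"] nz by simp
    moreover have "2\<^sup>2 = dir (1, 0, 0) TT z" using sq[of "(2 - Xx) / Xu"] nz by simp
    ultimately show False by simp
  qed
  then have Xx: "Xx \<noteq> 0" using TT_spatial(4)[OF z] by (auto simp: Xx_def Xu_def)
  show "dir (0, 0, 1) XX z = 0" "dir (0, 1, 0) XX z \<noteq> 0" "(dir (0, 1, 0) XX z)\<^sup>2 = dir (1, 0, 0) TT z"
    using Xu Xx sq[of 0] by (simp_all add: Xx_def Xu_def)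
  obtain w where w: "dir w TT z = 0" "dir w XX z = 0" "dir w UU z = 1" using derivative_surj[OF z] .
  obtain a b c where abc: "w = (a, b, c)" by (cases w)
  have "a = 0" using w(1) TT_dir[OF z, of a b c] TT_spatial(3)[OF z] abc by simp
  moreover from this have "b = 0" using w(2) dir_triple[OF smooth_components(2) z, of a b c] Xu Xx abc by (simp add: Xx_def Xu_def)
  ultimately show "dir (0, 0, 1) UU z \<noteq> 0" using w(3) dir_triple[OF smooth_components(3) z, of a b c] abc by auto
qed

text \<open>The jet used has vanishing second derivatives, so r is the affine function of s dictated
  by the source equation. The image slope g2 is affine in s too, hence so is the entire right
  side.\<close>

lemma UU_second_derivative:
  assumes z: "z = (t, x, u)" and z\<Omega>: "z \<in> \<Omega>"
    and XX0: "dir (0, 1, s) (dir (0, 1, s) XX) z = 0"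
    and r: "r = B (t, x) * s + Dx B (t, x) * u" and X1: "X1 = dir (0, 1, 0) XX z"
    and g2: "g2 = (dir (0, 1, 0) UU z + s * dir (0, 0, 1) UU z) / X1"
  shows "dir (0, 1, s) (dir (0, 1, s) UU) z = \<epsilon> * (dir (1, 0, 0) UU z + r * dir (0, 0, 1) UU z
      - g2 * dir (1, 0, 0) XX z) - \<epsilon> * X1\<^sup>2 * (B' (TT z, XX z) * g2 + Dx B' (TT z, XX z) * UU z)"
proof -
  have X1': "X1 \<noteq> 0" "dir (1, 0, 0) TT z = X1\<^sup>2" using XX_spatial[OF z\<Omega>] by (simp_all add: X1)
  have T_dir: "dir (0, 1, s) TT z = 0" "dir (1, 0, r) TT z = X1\<^sup>2"
    using TT_dir[OF z\<Omega>, of 0 1 s] TT_dir[OF z\<Omega>, of 1 0 r] X1' by simp_all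
  have X_dir: "dir (0, 1, s) XX z = X1" "dir (1, 0, r) XX z = dir (1, 0, 0) XX z"
    using dir_triple[OF smooth_components(2) z\<Omega>, of 0 1 s] dir_triple[OF smooth_components(2) z\<Omega>, of 1 0 r]
      XX_spatial(1)[OF z\<Omega>] by (simp_all add: X1)
  have J: "total_jacobian r s z \<noteq> 0"
    unfolding total_jacobian_def T_dir X_dir using X1'(1) by simp
  have E: "r = \<epsilon> * 0 + B (t, x) * s + Dx B (t, x) * u"
    by (simp add: r)
  obtain h1 h2 g11 \<sigma> g22 where rel0: "image_jet r s 0 0 z h1 h2 g11 \<sigma> g22"
    and rel3: "h1 = \<epsilon> * g22 + B' (TT z, XX z) * h2 + Dx B' (TT z, XX z) * UU z"
    by (rule jet_relations[OF z z\<Omega> J E, of 0]) (rule that)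
  note rel = image_jetD[OF rel0] rel3
  have h2: "h2 = g2"
    using rel(1)[of "(0, 1, s)" 0 1] T_dir X_dir X1' dir_triple[OF smooth_components(3) z\<Omega>, of 0 1 s]
    by (simp add: g2)
  have 1: "dir (1, 0, 0) UU z + r * dir (0, 0, 1) UU z = h1 * X1\<^sup>2 + g2 * dir (1, 0, 0) XX z"
    using rel(1)[of "(1, 0, r)" 1 0] T_dir X_dir dir_triple[OF smooth_components(3) z\<Omega>, of 1 0 r] h2 by simp
  have 2: "dir (0, 1, s) (dir (0, 1, s) UU) z = g22 * X1\<^sup>2"
    using rel(2)[of "(0, 1, s)" 0 1 0] T_dir X_dir TT_dir_dir[OF z\<Omega>] XX0 by simp
  \<comment> \<open>Lets the target equation be solved for g22.\<close>
  have "\<epsilon> * \<epsilon> = 1" using \<epsilon> by auto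
  then show ?thesis unfolding 2 using 1 rel(3) unfolding h2 by algebra
qed

text \<open>By \<open>UU_second_derivative\<close> the second derivative along (0, 1, s) is affine
  in s, whereas U_uu is its quadratic coefficient.\<close>

lemma UU_affine:
  assumes z\<Omega>: "z \<in> \<Omega>"
    and XX0: "\<And>s. dir (0, 1, s) (dir (0, 1, s) XX) z = 0"
  shows "dir (0, 0, 1) (dir (0, 0, 1) UU) z = 0"
proof -
  obtain t x u where z: "z = (t, x, u)" by (cases z)
  have "2 * dir (0, 0, 1) (dir (0, 0, 1) UU) z = 0"
    unfolding dir_dir_triple_second_difference[OF \<Omega>(1) smooth_components(3) z\<Omega>, symmetric]
      UU_second_derivative[OF z z\<Omega> XX0 refl refl refl]
    using XX_spatial(2)[OF z\<Omega>] by (simp add: field_simps)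
  then show ?thesis by simp
qed

end

section \<open>Reduction to functions of time and of the base\<close>

lemma smooth_function_of_time:
  fixes f :: "real \<times> real \<times> real \<Rightarrow> real"
  assumes \<Omega>: "open \<Omega>" and f: "smooth_on \<Omega> f"
    and const: "\<And>t x u x' u'. (t, x, u) \<in> \<Omega> \<Longrightarrow> (t, x', u') \<in> \<Omega> \<Longrightarrow> f (t, x, u) = f (t, x', u')"
  obtains c where "smooth_on (fst ` \<Omega>) c" "\<And>t x u. (t, x, u) \<in> \<Omega> \<Longrightarrow> f (t, x, u) = c t"
proof -
  define c where "c t = (SOME y. \<exists>x u. (t, x, u) \<in> \<Omega> \<and> y = f (t, x, u))" for t
  have c: "f (t, x, u) = c t" if "(t, x, u) \<in> \<Omega>" for t x u
  proof -
    have "\<exists>x' u'. (t, x', u') \<in> \<Omega> \<and> c t = f (t, x', u')"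
      unfolding c_def by (rule someI[of _ "f (t, x, u)"]) (use that in blast)
    then show ?thesis using const[OF that] by metis
  qed
  have "smooth_on (fst ` \<Omega>) c"
  proof (rule smooth_on_local)
    show op: "open (fst ` \<Omega>)" using \<Omega> by (rule open_image_fst)
    fix t assume "t \<in> fst ` \<Omega>"
    then obtain x u where z: "(t, x, u) \<in> \<Omega>" by force
    \<comment> \<open>With x and u frozen, c coincides near t with f along a line, so smoothness is
      independent of the choices made in defining c.\<close>
    define V where "V = (\<lambda>s. (s, x, u)) -` \<Omega>"
    have V: "open V" unfolding V_def by (intro open_vimage \<Omega> continuous_intros)
    have "smooth_on V (\<lambda>s. f (s, x, u))"
      by (rule smooth_on_compose[OF V f]) (auto simp: V_def intro!: smooth_intros V[unfolded V_def])
    then have "smooth_on V c" by (rule smooth_on_cong[OF V, rotated]) (auto simp: V_def c)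
    then show "\<exists>V. open V \<and> t \<in> V \<and> smooth_on (V \<inter> fst ` \<Omega>) c"
      using V z by (intro exI[of _ V]) (auto simp: V_def intro: smooth_on_subset)
  qed
  then show ?thesis using that c by blast
qed

lemma smooth_function_of_base:
  fixes f :: "real \<times> real \<times> real \<Rightarrow> real"
  assumes \<Omega>: "open \<Omega>" and f: "smooth_on \<Omega> f"
    and const: "\<And>t x u u'. (t, x, u) \<in> \<Omega> \<Longrightarrow> (t, x, u') \<in> \<Omega> \<Longrightarrow> f (t, x, u) = f (t, x, u')"
  obtains c where "smooth_on (base ` \<Omega>) c" "\<And>t x u. (t, x, u) \<in> \<Omega> \<Longrightarrow> f (t, x, u) = c (t, x)"
proof -
  define c where "c p = (SOME y. \<exists>u. (fst p, snd p, u) \<in> \<Omega> \<and> y = f (fst p, snd p, u))" for p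
  have c: "f (t, x, u) = c (t, x)" if "(t, x, u) \<in> \<Omega>" for t x u
  proof -
    have "\<exists>u'. (t, x, u') \<in> \<Omega> \<and> c (t, x) = f (t, x, u')"
      unfolding c_def fst_conv snd_conv by (rule someI[of _ "f (t, x, u)"]) (use that in blast)
    then show ?thesis using const[OF that] by metis
  qed
  have "smooth_on (base ` \<Omega>) c"
  proof (rule smooth_on_local)
    show "open (base ` \<Omega>)" using \<Omega> by (rule open_base_image)
    fix p assume "p \<in> base ` \<Omega>"
    then obtain u where z: "(fst p, snd p, u) \<in> \<Omega>" by force
    define V where "V = (\<lambda>q. (fst q, snd q, u)) -` \<Omega>"
    have V: "open V" unfolding V_def by (intro open_vimage \<Omega> continuous_intros)
    have "smooth_on V (\<lambda>q. f (fst q, snd q, u))"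
      by (rule smooth_on_compose[OF V f]) (auto simp: V_def intro!: smooth_intros V[unfolded V_def])
    then have "smooth_on V c" by (rule smooth_on_cong[OF V, rotated]) (auto simp: V_def c)
    then show "\<exists>V. open V \<and> p \<in> V \<and> smooth_on (V \<inter> base ` \<Omega>) c"
      using V z by (intro exI[of _ V]) (auto simp: V_def intro: smooth_on_subset)
  qed
  then show ?thesis using that c by blast
qed

lemma partial_has_derivative:
  fixes f :: "real \<times> real \<times> real \<Rightarrow> real"
  assumes "smooth_on \<Omega> f" "(t, x, u) \<in> \<Omega>"
  shows "((\<lambda>s. f (s, x, u)) has_real_derivative dir (1, 0, 0) f (t, x, u)) (at t)"
    and "((\<lambda>p. f (t, p)) has_derivative (\<lambda>h. fst h * dir (0, 1, 0) f (t, x, u) + snd h * dir (0, 0, 1) f (t, x, u))) (at (x, u))"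
    and "((\<lambda>v. f (t, x, v)) has_real_derivative dir (0, 0, 1) f (t, x, u)) (at u)"
proof -
  note f = smooth_on_has_derivative[OF assms]
  have "((\<lambda>s. (s, x, u)) has_vector_derivative (1, 0, 0)) (at t)" "((\<lambda>v. (t, x, v)) has_vector_derivative (0, 0, 1)) (at u)"
    by (intro has_vector_derivative_Pair; auto intro!: derivative_eq_intros)+
  from has_derivative_curve[of f _ "\<lambda>s. (s, x, u)", OF f this(1)] has_derivative_curve[of f _ "\<lambda>v. (t, x, v)", OF f this(2)]
  show "((\<lambda>s. f (s, x, u)) has_real_derivative dir (1, 0, 0) f (t, x, u)) (at t)"
    "((\<lambda>v. f (t, x, v)) has_real_derivative dir (0, 0, 1) f (t, x, u)) (at u)"
    by (simp_all add: has_real_derivative_iff_has_vector_derivative)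
  have "((\<lambda>p. (t, p)) has_derivative (\<lambda>h. (0, h))) (at (x, u))"
    by (auto intro!: derivative_eq_intros)
  from has_derivative_compose[OF this f]
  have "((\<lambda>p. f (t, p)) has_derivative (\<lambda>h. frechet_derivative f (at (t, x, u)) (0, fst h, snd h))) (at (x, u))"
    by simp
  then show "((\<lambda>p. f (t, p)) has_derivative (\<lambda>h. fst h * dir (0, 1, 0) f (t, x, u) + snd h * dir (0, 0, 1) f (t, x, u))) (at (x, u))"
    unfolding dir_triple[OF assms, of 0 "fst h" "snd h" for h] by simp
qed

lemma slice_constant:
  fixes g :: "real \<times> real \<Rightarrow> real"
  assumes "open \<Omega>" "connected_slices \<Omega>"
    and "\<And>p. (t, p) \<in> \<Omega> \<Longrightarrow> (g has_derivative (\<lambda>h. 0)) (at p)" and "(t, p) \<in> \<Omega>" "(t, q) \<in> \<Omega>"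
  shows "g p = g q"
proof (rule has_derivative_zero_unique_connected[of "{(x, u). (t, x, u) \<in> \<Omega>}" g])
  have eq: "{(x, u). (t, x, u) \<in> \<Omega>} = (\<lambda>p. (t, p)) -` \<Omega>" by auto
  show "open {(x, u). (t, x, u) \<in> \<Omega>}" unfolding eq by (intro open_vimage assms(1) continuous_intros)
  show "connected {(x, u). (t, x, u) \<in> \<Omega>}" using assms(2) by (simp add: connected_slices_def)
qed (use assms in auto)

lemma fiber_constant:
  fixes g :: "real \<Rightarrow> real"
  assumes "open \<Omega>" "connected_slices \<Omega>"
    and "\<And>u. (t, x, u) \<in> \<Omega> \<Longrightarrow> (g has_real_derivative 0) (at u)" and "(t, x, u) \<in> \<Omega>" "(t, x, u') \<in> \<Omega>"
  shows "g u = g u'"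
proof (rule has_derivative_zero_unique_connected[of "{u. (t, x, u) \<in> \<Omega>}" g])
  have eq: "{u. (t, x, u) \<in> \<Omega>} = (\<lambda>u. (t, x, u)) -` \<Omega>" by auto
  show "open {u. (t, x, u) \<in> \<Omega>}" unfolding eq by (intro open_vimage assms(1) continuous_intros)
  show "connected {u. (t, x, u) \<in> \<Omega>}" using assms(2) by (simp add: connected_slices_def)
  show "(g has_derivative (\<lambda>h. 0)) (at u)" if "u \<in> {u. (t, x, u) \<in> \<Omega>}" for u
    using assms(3)[of u] that unfolding has_field_derivative_def by (simp add: lambda_zero)
qed (use assms in auto)

text \<open>Two values of u over one base point separate the coefficient of u from the free term of
  the remainder.\<close>

lemma open_fiber_two_points:
  fixes \<Omega> :: "(real \<times> real \<times> real) set"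
  assumes "open \<Omega>" "(t, x, u) \<in> \<Omega>"
  obtains u' where "u' \<noteq> u" "(t, x, u') \<in> \<Omega>"
proof -
  have "open ((\<lambda>u. (t, x, u)) -` \<Omega>)" by (intro open_vimage assms(1) continuous_intros)
  then obtain e where "0 < e" "\<And>v. dist v u < e \<Longrightarrow> (t, x, v) \<in> \<Omega>"
    unfolding open_dist using assms(2) by (metis vimageE vimageI)
  then show ?thesis using that[of "u + e / 2"] by (simp add: dist_real_def)
qed

section \<open>Assembly of the normal form\<close>

context groupoid_element
begin

text \<open>The total Jacobian is now T_t X_x for every first-order jet, so over each point of
  \<open>\<Omega>\<close> every slope s occurs in a solution jet that has an image. Taking u_xx = 0
  fixes r.\<close>

lemma solution_jet:
  assumes z: "(t, x, u) \<in> \<Omega>"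
  obtains f j' where "(jet2 f (t, x), j') \<in> prolongation (\<Omega>, \<Phi>)" "f (t, x) = u" "Dx f (t, x) = s"
    "jet2 f (t, x) \<in> FP_equation \<epsilon> (D, B)" "j' \<in> FP_equation \<epsilon> (D', B')"
proof -
  define r where "r = B (t, x) * s + Dx B (t, x) * u"
  define f where "f = (\<lambda>p. u + r * (fst p - t) + s * (snd p - x) + 0 / 2 * (fst p - t)\<^sup>2 + 0 / 2 * (snd p - x)\<^sup>2)"
  have J: "total_jacobian r s (t, x, u) \<noteq> 0"
    unfolding total_jacobian_affine[OF z] using TT_spatial[OF z] XX_spatial[OF z] by simp
  obtain j' where j': "(jet2 f (t, x), j') \<in> prolongation (\<Omega>, \<Phi>)"
    by (rule prolongation_of_jet[OF refl z J f_def]) (rule that)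
  note f = quadratic_derivatives[OF f_def]
  have "(t, x) \<in> D" using \<Omega>(2) imageI[OF z, of base] by auto
  then have j: "jet2 f (t, x) \<in> FP_equation \<epsilon> (D, B)"
    unfolding jet2_in_FP_equation FP_residual_def f by (simp add: r_def)
  then have "j' \<in> FP_equation \<epsilon> (D', B')"
    using maps j' unfolding maps_equation_def by blast
  then show ?thesis using that j' f(1,3) j by blast
qed

lemma admissible_form_exists:
  assumes slices: "connected_slices \<Omega>"
  shows "\<exists>T X1 X0 U1 U0. admissible_form \<epsilon> B (\<Omega>, \<Phi>) (D', B') T X1 X0 U1 U0"
proof -
  obtain T where T: "smooth_on (fst ` \<Omega>) T" "\<And>t x u. (t, x, u) \<in> \<Omega> \<Longrightarrow> TT (t, x, u) = T t"
  proof (rule smooth_function_of_time[OF \<Omega>(1) smooth_components(1)])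
    fix t x u x' u' assume z: "(t, x, u) \<in> \<Omega>" "(t, x', u') \<in> \<Omega>"
    show "TT (t, x, u) = TT (t, x', u')"
    proof (rule slice_constant[where g = "\<lambda>p. TT (t, p)", OF \<Omega>(1) slices _ z])
      fix p assume "(t, p) \<in> \<Omega>"
      then show "((\<lambda>p. TT (t, p)) has_derivative (\<lambda>h. 0)) (at p)"
        using partial_has_derivative(2)[OF smooth_components(1), of t "fst p" "snd p"] TT_spatial[of "(t, p)"] by simp
    qed
  qed (rule that)
  have T_t: "deriv T t = dir (1, 0, 0) TT (t, x, u)" if z: "(t, x, u) \<in> \<Omega>" for t x u
  proof (rule DERIV_imp_deriv, rule has_field_derivative_transform_within_open)
    show "((\<lambda>s. TT (s, x, u)) has_real_derivative dir (1, 0, 0) TT (t, x, u)) (at t)"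
      by (rule partial_has_derivative(1)[OF smooth_components(1) z])
    show "open ((\<lambda>s. (s, x, u)) -` \<Omega>)" by (intro open_vimage \<Omega> continuous_intros)
  qed (use z T(2) in auto)
  obtain X1 where X1: "smooth_on (fst ` \<Omega>) X1" "\<And>t x u. (t, x, u) \<in> \<Omega> \<Longrightarrow> dir (0, 1, 0) XX (t, x, u) = X1 t"
  proof (rule smooth_function_of_time[OF \<Omega>(1) smooth_on_dir[OF smooth_components(2)]])
    fix t x u x' u' assume z: "(t, x, u) \<in> \<Omega>" "(t, x', u') \<in> \<Omega>"
    let ?S = "{(x, u). (t, x, u) \<in> \<Omega>}" and ?f = "\<lambda>p. dir (0, 1, 0) XX (t, p)"
    have "connected ?S" using slices by (simp add: connected_slices_def)
    moreover have "continuous_on ?S ?f"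
      by (rule continuous_on_compose2[OF smooth_on_continuous[OF smooth_on_dir[OF smooth_components(2)]]])
        (auto intro!: continuous_intros)
    \<comment> \<open>X_x is a square root of T_t, which depends on t alone; by continuity it cannot
      switch sign on a connected slice.\<close>
    moreover have "?f ` ?S \<subseteq> {sqrt (deriv T t), - sqrt (deriv T t)}"
    proof
      fix y assume "y \<in> ?f ` ?S"
      then obtain x u where z: "(t, x, u) \<in> \<Omega>" and y: "y = ?f (x, u)" by auto
      show "y \<in> {sqrt (deriv T t), - sqrt (deriv T t)}"
        unfolding y T_t[OF z] XX_spatial(3)[OF z, symmetric] by (auto simp: abs_if)
    qed
    then have "finite (?f ` ?S)" by (rule finite_subset) simp
    ultimately have "?f constant_on ?S" by (rule continuous_finite_range_constant)
    then show "?f (x, u) = ?f (x', u')" using z unfolding constant_on_def by force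
  qed (rule that)
  have X1_sq: "X1 t \<noteq> 0" "deriv T t = (X1 t)\<^sup>2" if "t \<in> fst ` \<Omega>" for t
    using that T_t XX_spatial(2,3) X1(2) by force+
  have XX_slope: "dir (0, 1, s) XX (t, x, u) = X1 t" if "(t, x, u) \<in> \<Omega>" for t x u s
    using dir_triple[OF smooth_components(2) that, of 0 1 s] XX_spatial(1)[OF that] X1(2)[OF that] by simp
  have X1_smooth: "smooth_on \<Omega> (\<lambda>z. X1 (fst z))"
    by (intro smooth_on_compose[OF \<Omega>(1) X1(1)] smooth_intros \<Omega>(1)) auto
  obtain X0 where X0: "smooth_on (fst ` \<Omega>) X0"
    "\<And>t x u. (t, x, u) \<in> \<Omega> \<Longrightarrow> XX (t, x, u) - X1 t * x = X0 t"
  proof (rule smooth_function_of_time[OF \<Omega>(1), of "\<lambda>z. XX z - X1 (fst z) * fst (snd z)"])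
    show "smooth_on \<Omega> (\<lambda>z. XX z - X1 (fst z) * fst (snd z))"
      by (intro smooth_intros \<Omega>(1) smooth_components X1_smooth)
    fix t x u x' u' assume z: "(t, x, u) \<in> \<Omega>" "(t, x', u') \<in> \<Omega>"
    have "(\<lambda>p. XX (t, p) - X1 t * fst p) (x, u) = (\<lambda>p. XX (t, p) - X1 t * fst p) (x', u')"
    proof (rule slice_constant[where g = "\<lambda>p. XX (t, p) - X1 t * fst p", OF \<Omega>(1) slices _ z])
      fix p assume p: "(t, p) \<in> \<Omega>"
      then have "(t, fst p, snd p) \<in> \<Omega>" by simp
      note d = partial_has_derivative(2)[OF smooth_components(2) this] and c = XX_spatial(1)[OF this] X1(2)[OF this]
      have "((\<lambda>p. XX (t, p) - X1 t * fst p) has_derivative (\<lambda>h. (fst h * X1 t + snd h * 0) - X1 t * fst h)) (at p)"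
        using d[unfolded c, unfolded prod.collapse] by (intro has_derivative_diff has_derivative_mult_right has_derivative_fst has_derivative_ident)
      then show "((\<lambda>p. XX (t, p) - X1 t * fst p) has_derivative (\<lambda>h. 0)) (at p)" by (simp add: mult.commute)
    qed
    then show "XX (t, x, u) - X1 (fst (t, x, u)) * fst (snd (t, x, u)) = XX (t, x', u') - X1 (fst (t, x', u')) * fst (snd (t, x', u'))"
      by simp
  qed (rule that, auto)
  \<comment> \<open>X_x + s X_u equals X1(t), which is constant in the direction (0, 1, s).\<close>
  have XX0: "dir (0, 1, s) (dir (0, 1, s) XX) z = 0" if z: "z \<in> \<Omega>" for s z
  proof -
    have "(X1 has_derivative frechet_derivative X1 (at (fst z))) (at (fst z))"
      by (rule smooth_on_has_derivative[OF X1(1)]) (use z in auto)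
    from has_derivative_compose[OF has_derivative_fst[OF has_derivative_ident] this]
    have "((\<lambda>z. X1 (fst z)) has_derivative (\<lambda>h. frechet_derivative X1 (at (fst z)) (fst h))) (at z)" .
    then have "(dir (0, 1, s) XX has_derivative (\<lambda>h. frechet_derivative X1 (at (fst z)) (fst h))) (at z)"
      by (rule has_derivative_transform_within_open[OF _ \<Omega>(1) z]) (auto simp: XX_slope)
    from fun_cong[OF frechet_derivative_at[OF this], of "(0, 1, s)"]
    show ?thesis
      using linear_0[OF has_derivative_linear[OF \<open>(X1 has_derivative _) _\<close>]] by simp
  qed
  have UU2: "dir (0, 0, 1) (dir (0, 0, 1) UU) z = 0" if "z \<in> \<Omega>" for z
    using UU_affine[OF that XX0[OF that]] .
  obtain U1 where U1: "smooth_on (base ` \<Omega>) U1" "\<And>t x u. (t, x, u) \<in> \<Omega> \<Longrightarrow> dir (0, 0, 1) UU (t, x, u) = U1 (t, x)"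
  proof (rule smooth_function_of_base[OF \<Omega>(1) smooth_on_dir[OF smooth_components(3)]])
    fix t x u u' assume z: "(t, x, u) \<in> \<Omega>" "(t, x, u') \<in> \<Omega>"
    show "dir (0, 0, 1) UU (t, x, u) = dir (0, 0, 1) UU (t, x, u')"
    proof (rule fiber_constant[where g = "\<lambda>u. dir (0, 0, 1) UU (t, x, u)", OF \<Omega>(1) slices _ z])
      fix u assume "(t, x, u) \<in> \<Omega>"
      from partial_has_derivative(3)[OF smooth_on_dir[OF smooth_components(3)] this, of "(0, 0, 1)"] UU2[OF this]
      show "((\<lambda>u. dir (0, 0, 1) UU (t, x, u)) has_real_derivative 0) (at u)" by simp
    qed
  qed (rule that)
  have U1_smooth: "smooth_on \<Omega> (\<lambda>z. U1 (base z))"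
    by (intro smooth_on_compose[OF \<Omega>(1) U1(1)] smooth_on_base \<Omega>(1)) auto
  obtain U0 where U0: "smooth_on (base ` \<Omega>) U0"
    "\<And>t x u. (t, x, u) \<in> \<Omega> \<Longrightarrow> UU (t, x, u) - U1 (t, x) * u = U0 (t, x)"
  proof (rule smooth_function_of_base[OF \<Omega>(1), of "\<lambda>z. UU z - U1 (base z) * snd (snd z)"])
    show "smooth_on \<Omega> (\<lambda>z. UU z - U1 (base z) * snd (snd z))"
      by (intro smooth_intros \<Omega>(1) smooth_components U1_smooth)
    fix t x u u' assume z: "(t, x, u) \<in> \<Omega>" "(t, x, u') \<in> \<Omega>"
    have "(\<lambda>u. UU (t, x, u) - U1 (t, x) * u) u = (\<lambda>u. UU (t, x, u) - U1 (t, x) * u) u'"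
    proof (rule fiber_constant[where g = "\<lambda>u. UU (t, x, u) - U1 (t, x) * u", OF \<Omega>(1) slices _ z])
      fix u assume z: "(t, x, u) \<in> \<Omega>"
      show "((\<lambda>u. UU (t, x, u) - U1 (t, x) * u) has_real_derivative 0) (at u)"
        using partial_has_derivative(3)[OF smooth_components(3) z] U1(2)[OF z]
        by (auto intro!: derivative_eq_intros)
    qed
    then show "UU (t, x, u) - U1 (base (t, x, u)) * snd (snd (t, x, u)) = UU (t, x, u') - U1 (base (t, x, u')) * snd (snd (t, x, u'))"
      by simp
  qed (rule that, auto)
  have U1_nz: "U1 p \<noteq> 0" if "p \<in> base ` \<Omega>" for p
    using that XX_spatial(4) U1(2) by force
  have \<Phi>_form: "\<Phi> (t, x, u) = (T t, X1 t * x + X0 t, U1 (t, x) * u + U0 (t, x))" if "(t, x, u) \<in> \<Omega>" for t x u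
    using T(2)[OF that] X0(2)[OF that] U0(2)[OF that] by (simp add: \<Phi>_eq)
  have WD': "(T t, X1 t * x + X0 t) \<in> D'" if tx: "(t, x) \<in> base ` \<Omega>" for t x
  proof -
    obtain u where "(t, x, u) \<in> \<Omega>" using tx by force
    then show ?thesis using \<Omega>(3) \<Phi>_form imageI[of _ _ "\<lambda>z. base (\<Phi> z)"] by (force simp: image_image)
  qed
  interpret fiber_affine_map "base ` \<Omega>" T X1 X0 U1 U0 \<epsilon> D D' B B' \<Omega> \<Phi>
    by unfold_locales
      (simp_all only: not_False_eq_True fst_base_image T(1) X1(1) X0(1) U1(1) U0(1) X1_sq U1_nz B B' \<Omega> WD' \<Phi>_form open_base_image)
  \<comment> \<open>An affine identity in (s, u) over each base point. Since s is arbitrary and u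
    ranges over an open set, its three coefficients must vanish separately.\<close>
  have rel: "coeff_ux (t, x) * s + (coeff U1 (t, x) + U1 (t, x) * Dx B (t, x)) * u + coeff U0 (t, x) = 0"
    if z: "(t, x, u) \<in> \<Omega>" for t x u s
  proof -
    obtain f j' where f: "(jet2 f (t, x), j') \<in> prolongation (\<Omega>, \<Phi>)" "f (t, x) = u" "Dx f (t, x) = s"
      "jet2 f (t, x) \<in> FP_equation \<epsilon> (D, B)" "j' \<in> FP_equation \<epsilon> (D', B')"
      by (rule solution_jet[OF z]) (rule that)
    \<comment> \<open>A pair in the prolongation records jets only, so \<open>f'\<close> may differ
      from \<open>f\<close>; the base point, value and slope are recovered from the common
      jet.\<close>
    obtain f' p g where g: "jet2 f (t, x) = jet2 f' p" "j' = jet2 g (\<phi> p)" "p \<in> base ` \<Omega>"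
      "(X1 (fst p))\<^sup>2 * FP_residual \<epsilon> B' g (\<phi> p) =
        U1 p * FP_residual \<epsilon> B f' p + coeff_ux p * Dx f' p + (coeff U1 p + U1 p * Dx B p) * f' p + coeff U0 p"
      by (rule prolongation_residual[OF f(1)]) (rule that)
    have "p = (t, x)" "f' p = u" "Dx f' p = s"
      using g(1) f(2,3) by (cases p; simp)+
    moreover have "FP_residual \<epsilon> B f' p = 0" using f(4) unfolding g(1) jet2_in_FP_equation by blast
    moreover have "FP_residual \<epsilon> B' g (\<phi> p) = 0" using f(5) unfolding g(2) jet2_in_FP_equation by blast
    ultimately show ?thesis using g(4) by simp
  qed
  have coeffs: "coeff_ux p = 0 \<and> coeff U1 p + U1 p * Dx B p = 0 \<and> coeff U0 p = 0" if p: "p \<in> base ` \<Omega>" for p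
  proof -
    obtain t x u where z: "p = (t, x)" "(t, x, u) \<in> \<Omega>" using p by force
    obtain u' where u': "u' \<noteq> u" "(t, x, u') \<in> \<Omega>" using open_fiber_two_points[OF \<Omega>(1) z(2)] .
    have 1: "coeff_ux p = 0" using rel[OF z(2), of 0] rel[OF z(2), of 1] z(1) by simp
    have "(coeff U1 p + U1 p * Dx B p) * (u' - u) = 0"
      using rel[OF z(2), of 0] rel[OF u'(2), of 0] unfolding z(1) by algebra
    then have 2: "coeff U1 p + U1 p * Dx B p = 0" using u'(1) by simp
    show ?thesis using 1 2 rel[OF z(2), of 0] z(1) by simp
  qed
  have ux: "coeff_ux p = 0" and u: "coeff U1 p + U1 p * Dx B p = 0" and u0: "coeff U0 p = 0" if "p \<in> base ` \<Omega>" for p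
    using coeffs[OF that] by auto
  have adjoint: "adjoint_solution \<epsilon> B (base ` \<Omega>) (\<lambda>(t, x). X1 t * U1 (t, x))"
    using adjoint_iff[OF ux] u by blast
  have quotient: "FP_solution \<epsilon> B (base ` \<Omega>) (\<lambda>p. U0 p / U1 p)"
    using FP_quotient_iff[OF ux u] u0 by blast
  have drift: "B' (T t, X1 t * x + X0 t) = 1 / X1 t * (B (t, x) - 2 * \<epsilon> * (Dx U1 (t, x) / U1 (t, x)))
      - (deriv X1 t * x + deriv X0 t) / (X1 t)\<^sup>2" if "(t, x) \<in> base ` \<Omega>" for t x
    using drift_relation_iff[OF that] ux[OF that] by (simp add: \<phi>_def)
  have nz: "X1 t * U1 (t, x) \<noteq> 0" if "(t, x) \<in> base ` \<Omega>" for t x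
    using X1_sq(1)[of t] U1_nz[OF that] imageI[OF that, of fst] by (simp add: fst_base_image)
  have ball_pair: "(\<forall>p\<in>S. case p of (t, x) \<Rightarrow> P t x) \<longleftrightarrow> (\<forall>t x. (t, x) \<in> S \<longrightarrow> P t x)" for S :: "('a \<times> 'b) set" and P
    by auto
  have "admissible_form \<epsilon> B (\<Omega>, \<Phi>) (D', B') T X1 X0 U1 U0"
    unfolding admissible_form_def prod.case ball_pair split_paired_All
    by (intro conjI allI impI ballI T[unfolded fst_base_image] X1[unfolded fst_base_image]
        X0[unfolded fst_base_image] U1 U0 adjoint quotient \<Phi>_form X1_sq nz WD' drift)
  then show ?thesis by blast
qed

end

theorem proposition32:
  fixes \<epsilon> :: real
    and B B' :: "real \<times> real \<Rightarrow> real" and D D' :: "(real \<times> real) set"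
    and \<Phi> :: "real \<times> real \<times> real \<Rightarrow> real \<times> real \<times> real" and \<Omega> :: "(real \<times> real \<times> real) set"
  assumes "\<epsilon> \<in> {-1, 1}"
    and "is_drift (D, B)" and "is_drift (D', B')"
    and "open \<Omega>" and "base ` \<Omega> \<subseteq> D" and "connected_slices \<Omega>"
  shows "((D, B), (\<Omega>, \<Phi>), (D', B')) \<in> equivalence_groupoid \<epsilon> \<longleftrightarrow>
    (\<exists>T X1 X0 U1 U0. admissible_form \<epsilon> B (\<Omega>, \<Phi>) (D', B') T X1 X0 U1 U0)"
proof
  assume "((D, B), (\<Omega>, \<Phi>), (D', B')) \<in> equivalence_groupoid \<epsilon>"
  then interpret groupoid_element \<epsilon> D D' B B' \<Omega> \<Phi>
    using assms unfolding equivalence_groupoid_def is_drift_def by unfold_locales auto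
  show "\<exists>T X1 X0 U1 U0. admissible_form \<epsilon> B (\<Omega>, \<Phi>) (D', B') T X1 X0 U1 U0"
    using assms(6) by (rule admissible_form_exists)
next
  assume "\<exists>T X1 X0 U1 U0. admissible_form \<epsilon> B (\<Omega>, \<Phi>) (D', B') T X1 X0 U1 U0"
  then obtain T X1 X0 U1 U0 where "admissible_form \<epsilon> B (\<Omega>, \<Phi>) (D', B') T X1 X0 U1 U0"
    by (elim exE)
  then show "((D, B), (\<Omega>, \<Phi>), (D', B')) \<in> equivalence_groupoid \<epsilon>"
    by (rule admissible_form_imp_groupoid[OF assms(2-5)])
qed

end
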